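(* Let $\tau$ be the Prouhet-Thue-Morse substitution over $\{a,b\}$, given by $\tau(a)=ab$ and $\tau(b)=ba$. The profinite group $G(\tau)$ has a group of order $18$ of rank three as a continuous homomorphic image. Hence, $G(\tau)$ has rank three.
   Context: The rank of a (pro)finite group is the minimum cardinality of a (topological) generating set. $\overline\Omega_A\mathsf S$ is the free profinite semigroup on the finite set $A$; the subsemigroup generated by $A$ is identified with the free semigroup $A^+$. A substitution over $A$ is an endomorphism $\varphi$ of $A^+$; it is primitive if there is $n\ge1$ such that every letter $c$ occurs in $\varphi^n(d)$ for all $c,d\in A$, and $\lim_n|\varphi^n(d)|=\infty$. A primitive $\varphi$ (such as $\tau$) defines a minimal subshift $\mathcal X_\varphi\subseteq A^{\mathbb Z}$ whose language $L(\mathcal X_\varphi)$ of finite blocks consists of the words that are factors of $\varphi^k(c)$ for all $c\in A$ and all sufficiently large $k$. The closure of $L(\mathcal X_\varphi)$ in $\overline\Omega_A\mathsf S$ is the disjoint union of $L(\mathcal X_\varphi)$ and a regular $\mathcal J$-class $J(\varphi)$. The Schützenberger group $G(\varphi)$ is the profinite group isomorphic to the maximal subgroups of $J(\varphi)$ (which are all isomorphic). *)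

theory Defs
  imports "HOL-Analysis.Analysis" "HOL-Algebra.Generated_Groups" "HOL-Library.Sublist"
begin

text \<open>
  The alphabet is a finite type \<^typ>\<open>'a\<close>; its free semigroup is the set of nonempty lists.
\<close>

definition words :: "'a::finite list set" where
  "words = {w. w \<noteq> []}"

definition fin_cong :: "('a::finite list \<times> 'a list) set \<Rightarrow> bool" where
  "fin_cong \<theta> \<longleftrightarrow> equiv words \<theta> \<and> finite (words // \<theta>) \<and>
     (\<forall>(u, v) \<in> \<theta>. \<forall>s \<in> words. (s @ u, s @ v) \<in> \<theta> \<and> (u @ s, v @ s) \<in> \<theta>)"

text \<open>
  The free profinite semigroup, as the inverse limit of the finite discrete quotients
  \<open>words // \<theta>\<close>: every finite semigroup generated by the alphabet is such a quotient.  The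
  connecting map for \<open>\<theta> \<subseteq> \<theta>'\<close> sends a class modulo \<open>\<theta>\<close> to the class modulo \<open>\<theta>'\<close> containing it.
\<close>

definition free_prof :: "(('a::finite list \<times> 'a list) set \<Rightarrow> 'a list set) set" where
  "free_prof = {x \<in> (\<Pi>\<^sub>E \<theta> \<in> Collect fin_cong. words // \<theta>).
     \<forall>\<theta> \<theta>'. fin_cong \<theta> \<longrightarrow> fin_cong \<theta>' \<longrightarrow> \<theta> \<subseteq> \<theta>' \<longrightarrow> x \<theta> \<subseteq> x \<theta>'}"

definition free_prof_mult ::
  "(('a::finite list \<times> 'a list) set \<Rightarrow> 'a list set) \<Rightarrow>
   (('a list \<times> 'a list) set \<Rightarrow> 'a list set) \<Rightarrow>
   (('a list \<times> 'a list) set \<Rightarrow> 'a list set)" where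
  "free_prof_mult x y =
     (\<lambda>\<theta> \<in> Collect fin_cong. \<theta> `` {u @ v |u v. u \<in> x \<theta> \<and> v \<in> y \<theta>})"

definition free_prof_topology ::
  "(('a::finite list \<times> 'a list) set \<Rightarrow> 'a list set) topology" where
  "free_prof_topology =
     subtopology (product_topology (\<lambda>\<theta>. discrete_topology (words // \<theta>)) (Collect fin_cong))
       free_prof"

definition embed_word :: "'a::finite list \<Rightarrow> (('a list \<times> 'a list) set \<Rightarrow> 'a list set)" where
  "embed_word w = (\<lambda>\<theta> \<in> Collect fin_cong. \<theta> `` {w})"

text \<open>A substitution is given by the images of the letters.\<close>

definition subst_word :: "('a \<Rightarrow> 'a list) \<Rightarrow> 'a list \<Rightarrow> 'a list" where
  "subst_word \<phi> w = concat (map \<phi> w)"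

text \<open>
  The nonempty blocks of the minimal subshift of a primitive substitution.
\<close>

definition subst_language :: "('a::finite \<Rightarrow> 'a list) \<Rightarrow> 'a list set" where
  "subst_language \<phi> =
     {w \<in> words. \<exists>K. \<forall>k \<ge> K. \<forall>c. sublist w ((subst_word \<phi> ^^ k) [c])}"

text \<open>
  For primitive \<open>\<phi>\<close> the closure of the language is the disjoint union of the language and
  a regular \<open>\<J>\<close>-class, which is therefore obtained as the difference.
\<close>

definition J_class ::
  "('a::finite \<Rightarrow> 'a list) \<Rightarrow> (('a list \<times> 'a list) set \<Rightarrow> 'a list set) set" where
  "J_class \<phi> = Abstract_Topology.closure_of free_prof_topology (embed_word ` subst_language \<phi>)
     - embed_word ` subst_language \<phi>"

text \<open>
  A subgroup of a semigroup \<open>S\<close> is a subset that is a group under the multiplication of \<open>S\<close>;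
  its identity is an idempotent of \<open>S\<close> depending on the subgroup.
\<close>

definition semigroup_subgroup :: "'s set \<Rightarrow> ('s \<Rightarrow> 's \<Rightarrow> 's) \<Rightarrow> 's monoid \<Rightarrow> bool" where
  "semigroup_subgroup S m G \<longleftrightarrow> group G \<and> carrier G \<subseteq> S \<and> mult G = m"

definition maximal_subgroup :: "'s set \<Rightarrow> ('s \<Rightarrow> 's \<Rightarrow> 's) \<Rightarrow> 's monoid \<Rightarrow> bool" where
  "maximal_subgroup S m G \<longleftrightarrow> semigroup_subgroup S m G \<and>
     (\<forall>H. semigroup_subgroup S m H \<longrightarrow> carrier G \<subseteq> carrier H \<longrightarrow> carrier H = carrier G)"

text \<open>
  The Schuetzenberger group is determined up to isomorphism only: each maximal subgroup of the
  free profinite semigroup contained in \<^const>\<open>J_class\<close> is a realization of it.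
\<close>

definition is_schutz_group ::
  "('a::finite \<Rightarrow> 'a list) \<Rightarrow> (('a list \<times> 'a list) set \<Rightarrow> 'a list set) monoid \<Rightarrow> bool" where
  "is_schutz_group \<phi> G \<longleftrightarrow>
     maximal_subgroup free_prof free_prof_mult G \<and> carrier G \<subseteq> J_class \<phi>"

definition schutz_topology ::
  "(('a::finite list \<times> 'a list) set \<Rightarrow> 'a list set) monoid \<Rightarrow>
   (('a list \<times> 'a list) set \<Rightarrow> 'a list set) topology" where
  "schutz_topology G = subtopology free_prof_topology (carrier G)"

definition top_generates :: "('g, 'm) monoid_scheme \<Rightarrow> 'g topology \<Rightarrow> 'g set \<Rightarrow> bool" where
  "top_generates G T X \<longleftrightarrow> X \<subseteq> carrier G \<and> Abstract_Topology.closure_of T (generate G X) = carrier G"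

text \<open>For a finite group \<open>T\<close> is the discrete topology, and the closure has no effect.\<close>

definition has_rank :: "('g, 'm) monoid_scheme \<Rightarrow> 'g topology \<Rightarrow> nat \<Rightarrow> bool" where
  "has_rank G T n \<longleftrightarrow>
     (\<exists>X. top_generates G T X \<and> finite X \<and> card X = n) \<and>
     (\<forall>X. top_generates G T X \<longrightarrow> finite X \<longrightarrow> n \<le> card X)"

definition continuous_hom_image ::
  "('g, 'm) monoid_scheme \<Rightarrow> 'g topology \<Rightarrow> ('h, 'n) monoid_scheme \<Rightarrow> 'h topology \<Rightarrow> bool" where
  "continuous_hom_image G T H T' \<longleftrightarrow>
     (\<exists>f \<in> hom G H. continuous_map T T' f \<and> f ` carrier G = carrier H)"

datatype letter = La | Lb

instance letter :: finite
proof
  have "(UNIV :: letter set) \<subseteq> {La, Lb}"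
    using letter.exhaust by blast
  then show "finite (UNIV :: letter set)"
    by (rule finite_subset) simp
qed

fun thue_morse :: "letter \<Rightarrow> letter list" where
  "thue_morse La = [La, Lb]"
| "thue_morse Lb = [Lb, La]"

end

theory Submission imports Defs begin

text \<open>
  An idempotent in the closure of the language of the Thue-Morse shift has as maximal subgroup the
  set of all elements of that closure on which it acts as a two-sided identity, and any two
  such groups are conjugate.  It thus suffices to study one idempotent \<open>f\<close>, chosen as the identity of
  the group containing the limit of the words \<open>\<tau>\<^sup>n\<^sup>!(ab)\<close>.  By recognizability its group is topologically
  generated by the limits of \<open>\<tau>\<^sup>n\<^sup>!(w)\<close>, where \<open>w\<close> is one of the return words \<open>ab\<close>, \<open>aab\<close>, \<open>abb\<close>, \<open>aabb\<close>
  to \<open>b.a\<close>; the last one is redundant since \<open>aabb = aab (ab)\<^sup>-\<^sup>1 abb\<close> holds in the group.  For the lower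
  bound, a product of weights of consecutive letters with values in the generalized dihedral group
  of order 18 is invariant under \<open>\<tau>\<^sup>4\<close>; it defines a homomorphism that sends the three generators to two
  independent translations and a reflection, and this group is not generated by two elements.
\<close>

section \<open>Finite congruences on words\<close>

text \<open>Products of profinite elements are manipulated algebraically, but every existence or
  density claim is settled at one finite congruence, with representative words, and then lifted by
  compactness. The obstacle is that a representative is known only up to congruence: its length, its
  ends and its factorizations are invisible unless the congruence records them. Hence the auxiliary
  congruences \<open>ends_cong\<close> and \<open>split_cong\<close>. Inverses and conjugating
  elements rest on one fact about finite semigroups, stability: an element that reappears inside a
  product with itself is recovered by multiplication on one side only.

  Factorial exponents are used because \<open>n!\<close> is eventually a multiple of any period, so
  the iterates of the substitution converge to an idempotent endomorphism.

  The number 3 in 18 = 2 * 3^2 comes from the fourth power of the substitution. In the image of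
  \<open>a\<close> the square \<open>bb\<close> occurs three times and all three occurrences push
  the same coordinate in the same direction, while the two occurrences of \<open>aa\<close> cancel;
  the image of \<open>b\<close> behaves in the same way with \<open>aa\<close> and \<open>bb\<close>
  exchanged. Translations of order 3 make both images neutral.\<close>

lemma words_iff [simp]: "w \<in> words \<longleftrightarrow> w \<noteq> []"
  by (simp add: words_def)

lemma fin_cong_equiv: "fin_cong \<theta> \<Longrightarrow> equiv words \<theta>"
  by (simp add: fin_cong_def)

lemma fin_cong_finite: "fin_cong \<theta> \<Longrightarrow> finite (words // \<theta>)"
  by (simp add: fin_cong_def)

lemma fin_cong_refl: "fin_cong \<theta> \<Longrightarrow> u \<noteq> [] \<Longrightarrow> (u, u) \<in> \<theta>"
  using fin_cong_equiv by (metis equiv_class_self Image_singleton_iff words_iff)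

lemma fin_cong_sym: "fin_cong \<theta> \<Longrightarrow> (u, v) \<in> \<theta> \<Longrightarrow> (v, u) \<in> \<theta>"
  by (meson equivE fin_cong_equiv symE)

lemma fin_cong_trans: "fin_cong \<theta> \<Longrightarrow> (u, v) \<in> \<theta> \<Longrightarrow> (v, w) \<in> \<theta> \<Longrightarrow> (u, w) \<in> \<theta>"
  by (meson equivE fin_cong_equiv transE)

lemma fin_cong_nonempty:
  assumes "fin_cong \<theta>" "(u, v) \<in> \<theta>"
  shows "u \<noteq> []" "v \<noteq> []"
  using fin_cong_equiv[OF assms(1)] assms(2) equiv_type by fastforce+

lemma fin_cong_prepend: "fin_cong \<theta> \<Longrightarrow> (u, v) \<in> \<theta> \<Longrightarrow> (s @ u, s @ v) \<in> \<theta>"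
  by (cases "s = []") (auto simp: fin_cong_def)

lemma fin_cong_append: "fin_cong \<theta> \<Longrightarrow> (u, v) \<in> \<theta> \<Longrightarrow> (u @ s, v @ s) \<in> \<theta>"
  by (cases "s = []") (auto simp: fin_cong_def)

lemma fin_cong_mult:
  "fin_cong \<theta> \<Longrightarrow> (u, u') \<in> \<theta> \<Longrightarrow> (v, v') \<in> \<theta> \<Longrightarrow> (u @ v, u' @ v') \<in> \<theta>"
  using fin_cong_append fin_cong_prepend fin_cong_trans by blast

lemma fin_cong_Image_eq:
  assumes "fin_cong \<theta>" "u \<noteq> []" "v \<noteq> []"
  shows "\<theta> `` {u} = \<theta> `` {v} \<longleftrightarrow> (u, v) \<in> \<theta>"
  using eq_equiv_class_iff[OF fin_cong_equiv[OF assms(1)]] assms by simp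

text \<open>The source of the concrete congruences below: each is the kernel of an invariant with
  finitely many values, and the invariant of a product has to depend only on the invariant of the
  factor that is replaced.\<close>

lemma fin_cong_kernel:
  fixes f :: "'a::finite list \<Rightarrow> 'b"
  assumes fin: "finite (f ` words)"
    and left: "\<And>u v s. u \<noteq> [] \<Longrightarrow> v \<noteq> [] \<Longrightarrow> s \<noteq> [] \<Longrightarrow> f u = f v \<Longrightarrow> f (s @ u) = f (s @ v)"
    and right: "\<And>u v s. u \<noteq> [] \<Longrightarrow> v \<noteq> [] \<Longrightarrow> s \<noteq> [] \<Longrightarrow> f u = f v \<Longrightarrow> f (u @ s) = f (v @ s)"
  shows "fin_cong {(u, v). u \<noteq> [] \<and> v \<noteq> [] \<and> f u = f v}" (is "fin_cong ?K")
proof -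
  have "equiv words ?K"
    by (intro equivI) (auto simp: refl_on_def sym_def trans_def)
  moreover have "words // ?K \<subseteq> (\<lambda>c. {v. v \<noteq> [] \<and> f v = c}) ` (f ` words)"
  proof
    fix X assume "X \<in> words // ?K"
    then obtain u where "u \<noteq> []" "X = {v. v \<noteq> [] \<and> f u = f v}"
      by (auto simp: quotient_def)
    then have "u \<noteq> []" "X = {v. v \<noteq> [] \<and> f v = f u}"
      by auto
    then show "X \<in> (\<lambda>c. {v. v \<noteq> [] \<and> f v = c}) ` (f ` words)"
      by simp
  qed
  then have "finite (words // ?K)"
    using fin by (meson finite_imageI finite_subset)
  moreover have "\<forall>(u, v) \<in> ?K. \<forall>s \<in> words. (s @ u, s @ v) \<in> ?K \<and> (u @ s, v @ s) \<in> ?K"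
    by (clarsimp, intro conjI left right)
  ultimately show ?thesis
    unfolding fin_cong_def by blast
qed

lemma fin_cong_Int:
  assumes "fin_cong \<theta>" "fin_cong \<eta>"
  shows "fin_cong (\<theta> \<inter> \<eta>)"
proof -
  let ?f = "\<lambda>w. (\<theta> `` {w}, \<eta> `` {w})"
  have eq: "?f u = ?f v \<longleftrightarrow> (u, v) \<in> \<theta> \<inter> \<eta>" if "u \<noteq> []" "v \<noteq> []" for u v
    using fin_cong_Image_eq[OF assms(1) that] fin_cong_Image_eq[OF assms(2) that] by auto
  have "?f ` words \<subseteq> (words // \<theta>) \<times> (words // \<eta>)"
    by (auto simp: quotientI)
  then have "finite (?f ` words)"
    by (rule finite_subset) (simp add: assms fin_cong_finite)
  then have "fin_cong {(u, v). u \<noteq> [] \<and> v \<noteq> [] \<and> ?f u = ?f v}"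
    using eq assms by (intro fin_cong_kernel)
      (auto simp: fin_cong_Image_eq fin_cong_prepend fin_cong_append)
  also have "{(u, v). u \<noteq> [] \<and> v \<noteq> [] \<and> ?f u = ?f v} = \<theta> \<inter> \<eta>"
    using eq fin_cong_nonempty[OF assms(1)] by blast
  finally show ?thesis .
qed

lemma fin_cong_universal: "fin_cong (words \<times> (words :: 'a::finite list set))"
proof -
  have "finite ((\<lambda>_::'a list. ()) ` words)"
    by simp
  then have "fin_cong {(u, v :: 'a list). u \<noteq> [] \<and> v \<noteq> [] \<and> () = ()}"
    by (rule fin_cong_kernel) auto
  then show ?thesis
    by (simp add: words_def)
qed

text \<open>Finite congruences are directed downwards. Therefore finitely many conditions at
  different congruences can be met with a single word.\<close>

lemma fin_cong_lower_bound:
  assumes "finite \<Theta>" "\<Theta> \<subseteq> Collect fin_cong"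
  shows "\<exists>\<theta>. fin_cong \<theta> \<and> (\<forall>\<eta>\<in>\<Theta>. \<theta> \<subseteq> \<eta>)"
  using assms
proof (induction \<Theta> rule: finite_induct)
  case empty
  then show ?case using fin_cong_universal by blast
next
  case (insert \<eta> \<Theta>)
  then obtain \<theta> where "fin_cong \<theta>" "\<forall>\<eta>\<in>\<Theta>. \<theta> \<subseteq> \<eta>"
    by auto
  with insert.prems show ?case
    by (intro exI[of _ "\<theta> \<inter> \<eta>"]) (auto intro: fin_cong_Int)
qed

text \<open>Makes the ends of a word visible in a finite quotient. A word shorter than
  \<open>N\<close> is alone in its class, so the class also tells whether the length reaches
  \<open>N\<close>.\<close>

definition ends_cong :: "nat \<Rightarrow> ('a::finite list \<times> 'a list) set" where
  "ends_cong N = {(u, v). u \<noteq> [] \<and> v \<noteq> [] \<and>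
     (take N u, take N (rev u)) = (take N v, take N (rev v))}"

lemma fin_cong_ends_cong: "fin_cong (ends_cong N :: ('a::finite list \<times> 'a list) set)"
  unfolding ends_cong_def
proof (rule fin_cong_kernel)
  have fin: "finite {w :: 'a list. length w \<le> N}"
    using finite_lists_length_le[of "UNIV :: 'a set" N] by simp
  show "finite ((\<lambda>w :: 'a list. (take N w, take N (rev w))) ` words)"
    by (rule finite_subset[OF _ finite_cartesian_product[OF fin fin]]) auto
next
  have take_app: "take N (s @ u) = take N (s @ v)" if "take N u = take N v" for s u v :: "'a list"
    using that by simp (metis diff_le_self min.absorb1 take_take)
  fix u v s :: "'a list"
  assume "(take N u, take N (rev u)) = (take N v, take N (rev v))"
  then have *: "take N u = take N v" "take N (rev u) = take N (rev v)"
    by auto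
  \<comment> \<open>The prefix of \<open>u @ s\<close> reaches into \<open>s\<close> only if
    \<open>u\<close> is shorter than \<open>N\<close>, and how far it reaches depends on the length
    of \<open>u\<close>. The same holds for suffixes of \<open>s @ u\<close>.\<close>
  then have len: "length u = length v \<or> (length u \<ge> N \<and> length v \<ge> N)"
    by (metis length_take min_def nle_le)
  show "(take N (s @ u), take N (rev (s @ u))) = (take N (s @ v), take N (rev (s @ v)))"
    using *(2) take_app[OF *(1)] len by auto
  show "(take N (u @ s), take N (rev (u @ s))) = (take N (v @ s), take N (rev (v @ s)))"
    using *(1) take_app[OF *(2)] len by auto
qed

text \<open>Besides the class of a word this remembers which pairs of classes arise by cutting it.
  It expresses that multiplication in the free profinite semigroup is open: every word close enough
  to a product can be cut into words close to the two factors.\<close>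

definition split_cong :: "('a::finite list \<times> 'a list) set \<Rightarrow> ('a list \<times> 'a list) set" where
  "split_cong \<theta> = {(u, v). u \<noteq> [] \<and> v \<noteq> [] \<and>
     (\<theta> `` {u}, {(\<theta> `` {p}, \<theta> `` {q}) |p q. p @ q = u \<and> p \<noteq> [] \<and> q \<noteq> []}) =
     (\<theta> `` {v}, {(\<theta> `` {p}, \<theta> `` {q}) |p q. p @ q = v \<and> p \<noteq> [] \<and> q \<noteq> []})}"

lemma fin_cong_split_cong:
  fixes \<theta> :: "('a::finite list \<times> 'a list) set"
  assumes "fin_cong \<theta>"
  shows "fin_cong (split_cong \<theta>)"
proof -
  define F where "F u = {(\<theta> `` {p}, \<theta> `` {q}) |p q. p @ q = u \<and> p \<noteq> [] \<and> q \<noteq> []}" for u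
  have FI: "(\<theta> `` {p}, \<theta> `` {q}) \<in> F u" if "p @ q = u" "p \<noteq> []" "q \<noteq> []" for p q u
    using that unfolding F_def by blast
  have FE: "\<exists>p q. X = \<theta> `` {p} \<and> Y = \<theta> `` {q} \<and> p @ q = u \<and> p \<noteq> [] \<and> q \<noteq> []"
    if "(X, Y) \<in> F u" for X Y u
    using that unfolding F_def by blast
  have rel: "(p, p') \<in> \<theta>" if "\<theta> `` {p} = \<theta> `` {p'}" "p \<noteq> []" "p' \<noteq> []" for p p'
    using fin_cong_Image_eq[OF assms that(2,3)] that(1) by blast
  have eqI: "\<theta> `` {p} = \<theta> `` {p'}" if "(p, p') \<in> \<theta>" for p p'
    using that fin_cong_Image_eq[OF assms] fin_cong_nonempty[OF assms that] by blast
  have left: "F (s @ u) \<subseteq> F (s @ v)"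
    if uv: "\<theta> `` {u} = \<theta> `` {v}" "F u = F v" and ne: "u \<noteq> []" "v \<noteq> []" for s u v
  proof clarify
    fix X Y assume "(X, Y) \<in> F (s @ u)"
    then obtain p q where pq: "X = \<theta> `` {p}" "Y = \<theta> `` {q}" "p @ q = s @ u" "p \<noteq> []" "q \<noteq> []"
      using FE by blast
    \<comment> \<open>The cut falls inside or at the end of \<open>s\<close>, or else strictly
      inside \<open>u\<close>. In the second case the pair at this cut of \<open>u\<close> is
      matched by a cut of \<open>v\<close>.\<close>
    then consider r where "p @ r = s" "q = r @ u" | r where "p = s @ r" "r @ q = u" "r \<noteq> []"
      by (metis append_eq_append_conv2 append_Nil append_Nil2)
    then show "(X, Y) \<in> F (s @ v)"
    proof cases
      case 1
      have "\<theta> `` {q} = \<theta> `` {r @ v}"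
        using 1 eqI[OF fin_cong_prepend[OF assms rel[OF uv(1) ne]]] by simp
      then show ?thesis
        using FI[of p "r @ v" "s @ v"] 1 pq ne by auto
    next
      case 2
      then have "(\<theta> `` {r}, \<theta> `` {q}) \<in> F v"
        using FI[of r q u] pq uv by simp
      then obtain r' q' where r': "\<theta> `` {r} = \<theta> `` {r'}" "\<theta> `` {q} = \<theta> `` {q'}"
        "r' @ q' = v" "r' \<noteq> []" "q' \<noteq> []"
        using FE by blast
      then have "\<theta> `` {p} = \<theta> `` {s @ r'}"
        using 2 eqI[OF fin_cong_prepend[OF assms rel[of r r']]] by simp
      then show ?thesis
        using FI[of "s @ r'" q' "s @ v"] pq r' by auto
    qed
  qed
  have right: "F (u @ s) \<subseteq> F (v @ s)"
    if uv: "\<theta> `` {u} = \<theta> `` {v}" "F u = F v" and ne: "u \<noteq> []" "v \<noteq> []" for s u v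
  proof clarify
    fix X Y assume "(X, Y) \<in> F (u @ s)"
    then obtain p q where pq: "X = \<theta> `` {p}" "Y = \<theta> `` {q}" "p @ q = u @ s" "p \<noteq> []" "q \<noteq> []"
      using FE by blast
    then consider r where "r @ q = s" "p = u @ r" | r where "q = r @ s" "p @ r = u" "r \<noteq> []"
      by (metis append_eq_append_conv2 append_Nil append_Nil2)
    then show "(X, Y) \<in> F (v @ s)"
    proof cases
      case 1
      have "\<theta> `` {p} = \<theta> `` {v @ r}"
        using 1 eqI[OF fin_cong_append[OF assms rel[OF uv(1) ne]]] by simp
      then show ?thesis
        using FI[of "v @ r" q "v @ s"] 1 pq ne by auto
    next
      case 2
      then have "(\<theta> `` {p}, \<theta> `` {r}) \<in> F v"
        using FI[of p r u] pq uv by simp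
      then obtain p' r' where r': "\<theta> `` {p} = \<theta> `` {p'}" "\<theta> `` {r} = \<theta> `` {r'}"
        "p' @ r' = v" "p' \<noteq> []" "r' \<noteq> []"
        using FE by blast
      then have "\<theta> `` {q} = \<theta> `` {r' @ s}"
        using 2 eqI[OF fin_cong_append[OF assms rel[of r r']]] by simp
      then show ?thesis
        using FI[of p' "r' @ s" "v @ s"] pq r' by auto
    qed
  qed
  have "(\<lambda>u. (\<theta> `` {u}, F u)) ` words \<subseteq> (words // \<theta>) \<times> Pow ((words // \<theta>) \<times> (words // \<theta>))"
    by (auto simp: F_def quotientI)
  then have fin: "finite ((\<lambda>u. (\<theta> `` {u}, F u)) ` words)"
    by (rule finite_subset) (simp add: fin_cong_finite[OF assms])
  have "fin_cong {(u, v). u \<noteq> [] \<and> v \<noteq> [] \<and> (\<theta> `` {u}, F u) = (\<theta> `` {v}, F v)}"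
  proof (rule fin_cong_kernel[OF fin])
    fix u v s :: "'a list"
    assume ne: "u \<noteq> []" "v \<noteq> []" and "(\<theta> `` {u}, F u) = (\<theta> `` {v}, F v)"
    then have uv: "\<theta> `` {u} = \<theta> `` {v}" "F u = F v"
      by auto
    show "(\<theta> `` {s @ u}, F (s @ u)) = (\<theta> `` {s @ v}, F (s @ v))"
      using left[OF uv ne] left[OF uv[symmetric] ne(2,1)]
        eqI[OF fin_cong_prepend[OF assms rel[OF uv(1) ne]]] by auto
    show "(\<theta> `` {u @ s}, F (u @ s)) = (\<theta> `` {v @ s}, F (v @ s))"
      using right[OF uv ne] right[OF uv[symmetric] ne(2,1)]
        eqI[OF fin_cong_append[OF assms rel[OF uv(1) ne]]] by auto
  qed
  then show ?thesis
    unfolding split_cong_def F_def .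
qed

lemma split_congD:
  assumes "fin_cong \<theta>" "(p @ q, v) \<in> split_cong \<theta>" "p \<noteq> []" "q \<noteq> []"
  shows "\<exists>p' q'. v = p' @ q' \<and> (p, p') \<in> \<theta> \<and> (q, q') \<in> \<theta>"
proof -
  have "(\<theta> `` {p}, \<theta> `` {q}) \<in> {(\<theta> `` {p'}, \<theta> `` {q'}) |p' q'. p' @ q' = v \<and> p' \<noteq> [] \<and> q' \<noteq> []}"
    using assms unfolding split_cong_def by blast
  then show ?thesis
    using fin_cong_Image_eq[OF assms(1)] assms(3,4) by auto
qed

section \<open>The free profinite semigroup\<close>

lemma free_prof_class:
  assumes "x \<in> free_prof" "fin_cong \<theta>"
  shows "x \<theta> \<in> words // \<theta>"
  using assms unfolding free_prof_def by auto

lemma free_prof_rep: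
  assumes "x \<in> free_prof" "fin_cong \<theta>"
  obtains w where "w \<in> x \<theta>" "w \<noteq> []"
  using free_prof_class[OF assms] fin_cong_equiv[OF assms(2)]
  by (metis quotientE equiv_class_self words_iff)

lemma free_prof_rel:
  assumes "x \<in> free_prof" "fin_cong \<theta>" "w \<in> x \<theta>"
  shows "v \<in> x \<theta> \<longleftrightarrow> (w, v) \<in> \<theta>"
  using free_prof_class[OF assms(1,2)] fin_cong_equiv[OF assms(2)] assms(3)
  by (meson in_quotient_imp_closed in_quotient_imp_in_rel empty_subsetI insert_subset)

lemma free_prof_eq_Image:
  assumes "x \<in> free_prof" "fin_cong \<theta>" "w \<in> x \<theta>"
  shows "x \<theta> = \<theta> `` {w}"
  using free_prof_rel[OF assms] by auto

lemma free_prof_nonempty: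
  assumes "x \<in> free_prof" "fin_cong \<theta>" "w \<in> x \<theta>"
  shows "w \<noteq> []"
  using free_prof_rel[OF assms] assms fin_cong_nonempty by blast

lemma free_prof_mono:
  assumes "x \<in> free_prof" "fin_cong \<theta>" "fin_cong \<eta>" "\<theta> \<subseteq> \<eta>" "w \<in> x \<theta>"
  shows "w \<in> x \<eta>"
  using assms unfolding free_prof_def by blast

text \<open>Classes with a common element coincide, so two elements are equal as soon as they share
  a representative at each congruence. This is how most identities below are verified.\<close>

lemma free_prof_eqI:
  assumes "x \<in> free_prof" "y \<in> free_prof"
    and "\<And>\<theta>. fin_cong \<theta> \<Longrightarrow> \<exists>w. w \<in> x \<theta> \<and> w \<in> y \<theta>"
  shows "x = y"
proof (rule PiE_ext)
  show "x \<in> (\<Pi>\<^sub>E \<theta> \<in> Collect fin_cong. words // \<theta>)" "y \<in> (\<Pi>\<^sub>E \<theta> \<in> Collect fin_cong. words // \<theta>)"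
    using assms unfolding free_prof_def by auto
  show "x \<theta> = y \<theta>" if "\<theta> \<in> Collect fin_cong" for \<theta>
    using assms(3)[of \<theta>] that free_prof_eq_Image[of x \<theta>] free_prof_eq_Image[of y \<theta>] assms(1,2)
    by auto
qed

section \<open>Multiplication in the inverse limit\<close>

notation free_prof_mult (infixl "\<odot>" 70)

lemma free_prof_mult_eq:
  assumes "x \<in> free_prof" "y \<in> free_prof" "fin_cong \<theta>" "u \<in> x \<theta>" "v \<in> y \<theta>"
  shows "(x \<odot> y) \<theta> = \<theta> `` {u @ v}"
proof -
  have "(u @ v, u' @ v') \<in> \<theta>" if "u' \<in> x \<theta>" "v' \<in> y \<theta>" for u' v'
    using that assms(4,5) free_prof_rel[OF assms(1,3)] free_prof_rel[OF assms(2,3)]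
    by (intro fin_cong_mult[OF assms(3)]) auto
  then have "(w, v') \<in> \<theta> \<longleftrightarrow> (u @ v, v') \<in> \<theta>"
    if "w \<in> {u @ v |u v. u \<in> x \<theta> \<and> v \<in> y \<theta>}" for w v'
    using that fin_cong_trans[OF assms(3)] fin_cong_sym[OF assms(3)] by blast
  then show ?thesis
    using assms(3-5) unfolding free_prof_mult_def by auto
qed

lemma free_prof_mult_rep:
  assumes "x \<in> free_prof" "y \<in> free_prof" "fin_cong \<theta>" "u \<in> x \<theta>" "v \<in> y \<theta>"
  shows "u @ v \<in> (x \<odot> y) \<theta>"
  using free_prof_mult_eq[OF assms] fin_cong_refl[OF assms(3)]
    free_prof_nonempty[OF assms(1,3,4)] by auto

lemma free_prof_mult_closed [intro, simp]:
  assumes x: "x \<in> free_prof" and y: "y \<in> free_prof"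
  shows "x \<odot> y \<in> free_prof"
proof -
  have "x \<odot> y \<in> (\<Pi>\<^sub>E \<theta> \<in> Collect fin_cong. words // \<theta>)"
  proof (rule PiE_I)
    fix \<theta> assume "\<theta> \<in> Collect (fin_cong :: ('a list \<times> 'a list) set \<Rightarrow> bool)"
    then have \<theta>: "fin_cong \<theta>" by simp
    obtain u v where "u \<in> x \<theta>" "v \<in> y \<theta>" "u \<noteq> []"
      using free_prof_rep[OF x \<theta>] free_prof_rep[OF y \<theta>] by metis
    then show "(x \<odot> y) \<theta> \<in> words // \<theta>"
      using free_prof_mult_eq[OF x y \<theta>] by (simp add: quotientI)
  qed (simp add: free_prof_mult_def)
  moreover have "(x \<odot> y) \<theta> \<subseteq> (x \<odot> y) \<eta>"
    if \<theta>: "fin_cong \<theta>" and \<eta>: "fin_cong \<eta>" and sub: "\<theta> \<subseteq> \<eta>" for \<theta> \<eta>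
  proof -
    obtain u v where uv: "u \<in> x \<theta>" "v \<in> y \<theta>"
      using free_prof_rep[OF x \<theta>] free_prof_rep[OF y \<theta>] by metis
    then have "u \<in> x \<eta>" "v \<in> y \<eta>"
      using free_prof_mono x y \<theta> \<eta> sub by blast+
    then show ?thesis
      using free_prof_mult_eq[OF x y \<theta> uv] free_prof_mult_eq[OF x y \<eta>] sub by auto
  qed
  ultimately show ?thesis
    unfolding free_prof_def by simp
qed

lemma free_prof_mult_assoc:
  assumes x: "x \<in> free_prof" and y: "y \<in> free_prof" and z: "z \<in> free_prof"
  shows "x \<odot> y \<odot> z = x \<odot> (y \<odot> z)"
proof (rule free_prof_eqI)
  fix \<theta> :: "('a list \<times> 'a list) set" assume \<theta>: "fin_cong \<theta>"
  obtain u v w where "u \<in> x \<theta>" "v \<in> y \<theta>" "w \<in> z \<theta>"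
    using free_prof_rep[OF x \<theta>] free_prof_rep[OF y \<theta>] free_prof_rep[OF z \<theta>] by metis
  then have "u @ v @ w \<in> (x \<odot> y \<odot> z) \<theta>" "u @ v @ w \<in> (x \<odot> (y \<odot> z)) \<theta>"
    using free_prof_mult_rep[OF _ _ \<theta>] x y z free_prof_mult_closed append_assoc by metis+
  then show "\<exists>w. w \<in> (x \<odot> y \<odot> z) \<theta> \<and> w \<in> (x \<odot> (y \<odot> z)) \<theta>"
    by blast
qed (use assms in auto)

text \<open>
  By Tychonoff's theorem, it is enough to satisfy the finitely many closed conditions that concern
  the congruences above a given one.
\<close>

lemma free_prof_compactness:
  fixes P :: "('a::finite list \<times> 'a list) set \<Rightarrow> 'a list set \<Rightarrow> bool"
  assumes ex: "\<And>\<theta>. fin_cong \<theta> \<Longrightarrow> \<exists>C \<in> words // \<theta>. P \<theta> C"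
    and mono: "\<And>\<theta> \<eta> C D. \<lbrakk>fin_cong \<theta>; fin_cong \<eta>; \<theta> \<subseteq> \<eta>; C \<in> words // \<theta>; D \<in> words // \<eta>; C \<subseteq> D; P \<theta> C\<rbrakk>
      \<Longrightarrow> P \<eta> D"
  shows "\<exists>x \<in> free_prof. \<forall>\<theta>. fin_cong \<theta> \<longrightarrow> P \<theta> (x \<theta>)"
proof -
  let ?I = "Collect (fin_cong :: ('a list \<times> 'a list) set \<Rightarrow> bool)"
  let ?X = "product_topology (\<lambda>\<theta>. discrete_topology (words // \<theta>)) ?I"
  have compact: "compact_space ?X"
    unfolding compact_space_product_topology
    by (simp add: fin_cong_finite compact_space_discrete_topology)
  have cont: "continuous_map ?X (discrete_topology (words // \<theta>)) (\<lambda>x. x \<theta>)" if "fin_cong \<theta>" for \<theta>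
    using that by (intro continuous_map_product_projection) simp
  define A where "A \<theta> = {x \<in> topspace ?X. x \<theta> \<in> {C \<in> words // \<theta>. P \<theta> C}}" for \<theta>
  \<comment> \<open>\<open>A\<close> imposes the condition \<open>P\<close> at one congruence and
    \<open>B\<close> imposes coherence between two of them. Each is closed, being a finite union of
    sets that prescribe at most two coordinates.\<close>
  define B where "B \<theta> \<eta> =
    (\<Union>C \<in> words // \<theta>. {x \<in> topspace ?X. x \<theta> \<in> {C}} \<inter> {x \<in> topspace ?X. x \<eta> \<in> {D \<in> words // \<eta>. C \<subseteq> D}})"
    for \<theta> \<eta>
  define U where "U = (A ` ?I) \<union> {B \<theta> \<eta> |\<theta> \<eta>. fin_cong \<theta> \<and> fin_cong \<eta> \<and> \<theta> \<subseteq> \<eta>}"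
  have closed: "closedin ?X {x \<in> topspace ?X. x \<theta> \<in> S}" if "fin_cong \<theta>" "S \<subseteq> words // \<theta>" for \<theta> S
    using closedin_continuous_map_preimage[OF cont[OF that(1)], of S] that(2) by simp
  have "closedin ?X (A \<theta>)" if "fin_cong \<theta>" for \<theta>
    unfolding A_def by (rule closed[OF that]) auto
  moreover have "closedin ?X (B \<theta> \<eta>)" if "fin_cong \<theta>" "fin_cong \<eta>" for \<theta> \<eta>
    unfolding B_def
  proof (rule closedin_Union)
    show "finite ((\<lambda>C. {x \<in> topspace ?X. x \<theta> \<in> {C}} \<inter>
      {x \<in> topspace ?X. x \<eta> \<in> {D \<in> words // \<eta>. C \<subseteq> D}}) ` (words // \<theta>))"
      using that fin_cong_finite by blast
    fix K assume "K \<in> (\<lambda>C. {x \<in> topspace ?X. x \<theta> \<in> {C}} \<inter>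
      {x \<in> topspace ?X. x \<eta> \<in> {D \<in> words // \<eta>. C \<subseteq> D}}) ` (words // \<theta>)"
    then obtain C where "C \<in> words // \<theta>" "K = {x \<in> topspace ?X. x \<theta> \<in> {C}} \<inter>
      {x \<in> topspace ?X. x \<eta> \<in> {D \<in> words // \<eta>. C \<subseteq> D}}"
      by blast
    then show "closedin ?X K"
      using closed[OF that(1), of "{C}"] closed[OF that(2), of "{D \<in> words // \<eta>. C \<subseteq> D}"]
      by (metis (no_types, lifting) closedin_Int empty_subsetI insert_subset mem_Collect_eq subsetI)
  qed
  ultimately have closedU: "\<And>C. C \<in> U \<Longrightarrow> closedin ?X C"
    unfolding U_def by auto
  have fip: "\<Inter> F \<noteq> {}" if F: "finite F" "F \<subseteq> U" for F
  proof -
    have "\<exists>g. \<forall>K \<in> F. fin_cong (g K) \<and> (K = A (g K) \<or> (\<exists>\<eta>. fin_cong \<eta> \<and> g K \<subseteq> \<eta> \<and> K = B (g K) \<eta>))"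
      using F(2) unfolding U_def by (intro bchoice) blast
    then obtain g where g: "\<forall>K \<in> F. fin_cong (g K) \<and> (K = A (g K) \<or> (\<exists>\<eta>. fin_cong \<eta> \<and> g K \<subseteq> \<eta> \<and> K = B (g K) \<eta>))"
      by blast
    obtain \<theta> where \<theta>: "fin_cong \<theta>" "\<forall>\<eta> \<in> g ` F. \<theta> \<subseteq> \<eta>"
      using fin_cong_lower_bound[of "g ` F"] F(1) g by auto
    obtain C where C: "C \<in> words // \<theta>" "P \<theta> C"
      using ex[OF \<theta>(1)] by blast
    obtain w where w: "C = \<theta> `` {w}" "w \<noteq> []"
      using C(1) by (auto elim: quotientE)
    \<comment> \<open>One word chosen at a common refinement lies in all members of
      \<open>F\<close>: its classes are coherent automatically, and \<open>P\<close> passes from the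
      refinement to coarser congruences by \<open>mono\<close>.\<close>
    define x where "x = (\<lambda>\<eta> \<in> ?I. \<eta> `` {w})"
    have x: "x \<in> topspace ?X"
      using w(2) by (auto simp: x_def quotientI)
    have "x \<in> K" if "K \<in> F" for K
    proof -
      have gK: "fin_cong (g K)" "\<theta> \<subseteq> g K"
        using g \<theta> that by auto
      have q: "g K `` {w} \<in> words // g K"
        using w(2) by (simp add: quotientI)
      have "P (g K) (g K `` {w})"
        by (rule mono[OF \<theta>(1) gK C(1) q _ C(2)]) (use w gK in auto)
      then have "x \<in> A (g K)"
        using x gK q by (simp add: A_def x_def)
      moreover have "x \<in> B (g K) \<eta>" if "fin_cong \<eta>" "g K \<subseteq> \<eta>" for \<eta>
      proof -
        have "\<eta> `` {w} \<in> words // \<eta>" "g K `` {w} \<subseteq> \<eta> `` {w}"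
          using w(2) that by (auto simp: quotientI)
        then show ?thesis
          using x gK q that unfolding B_def x_def by (auto intro!: bexI[of _ "g K `` {w}"])
      qed
      ultimately show ?thesis
        using g that by metis
    qed
    then show ?thesis by blast
  qed
  have "\<Inter> U \<noteq> {}"
    using compact closedU fip unfolding compact_space_fip by blast
  then obtain x where x: "x \<in> \<Inter> U" by blast
  then have xA: "x \<in> A \<theta>" if "fin_cong \<theta>" for \<theta>
    using that unfolding U_def by blast
  have xB: "x \<theta> \<subseteq> x \<eta>" if "fin_cong \<theta>" "fin_cong \<eta>" "\<theta> \<subseteq> \<eta>" for \<theta> \<eta>
  proof -
    have "x \<in> B \<theta> \<eta>"
      using x that unfolding U_def by blast
    then show ?thesis
      unfolding B_def by auto
  qed
  have "x \<in> topspace ?X"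
    using xA[OF fin_cong_universal] by (simp add: A_def)
  with xB have "x \<in> free_prof"
    unfolding free_prof_def by auto
  moreover have "P \<theta> (x \<theta>)" if "fin_cong \<theta>" for \<theta>
    using xA[OF that] by (simp add: A_def)
  ultimately show ?thesis by blast
qed

section \<open>The topology, read off from single congruences\<close>

lemma topspace_free_prof_topology [simp]: "topspace free_prof_topology = free_prof"
  unfolding free_prof_topology_def free_prof_def by (auto simp: PiE_def)

text \<open>A basic open set of the product restricts finitely many coordinates. For coherent
  families a common refinement decides all of these, so one coordinate suffices.\<close>

lemma openin_free_prof_topology:
  fixes U :: "(('a::finite list \<times> 'a list) set \<Rightarrow> 'a list set) set"
  shows "openin free_prof_topology U \<longleftrightarrow>
    U \<subseteq> free_prof \<and> (\<forall>x \<in> U. \<exists>\<theta>. fin_cong \<theta> \<and> {y \<in> free_prof. y \<theta> = x \<theta>} \<subseteq> U)"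
    (is "_ = ?R")
proof
  let ?I = "Collect (fin_cong :: ('a list \<times> 'a list) set \<Rightarrow> bool)"
  let ?X = "product_topology (\<lambda>\<theta>. discrete_topology (words // \<theta>)) ?I"
  assume "openin free_prof_topology U"
  then obtain V where V: "openin ?X V" "U = V \<inter> free_prof"
    unfolding free_prof_topology_def openin_subtopology by blast
  have "\<exists>\<theta>. fin_cong \<theta> \<and> {y \<in> free_prof. y \<theta> = x \<theta>} \<subseteq> U" if "x \<in> U" for x
  proof -
    have x: "x \<in> V" "x \<in> free_prof"
      using V that by auto
    obtain W where W: "finite {\<theta> \<in> ?I. W \<theta> \<noteq> topspace (discrete_topology (words // \<theta>))}"
      "x \<in> Pi\<^sub>E ?I W" "Pi\<^sub>E ?I W \<subseteq> V"
      using V(1) x(1) unfolding openin_product_topology_alt by meson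
    obtain \<theta> where \<theta>: "fin_cong \<theta>" "\<And>\<eta>. fin_cong \<eta> \<Longrightarrow> W \<eta> \<noteq> words // \<eta> \<Longrightarrow> \<theta> \<subseteq> \<eta>"
      using fin_cong_lower_bound[OF W(1)] unfolding topspace_discrete_topology by blast
    have "y \<in> V" if y: "y \<in> free_prof" "y \<theta> = x \<theta>" for y
    proof -
      have "y \<eta> \<in> W \<eta>" if \<eta>: "fin_cong \<eta>" for \<eta>
      proof (cases "W \<eta> = words // \<eta>")
        case True
        then show ?thesis
          using free_prof_class[OF y(1) \<eta>] by simp
      next
        case False
        then have sub: "\<theta> \<subseteq> \<eta>"
          using \<theta> \<eta> by blast
        obtain w where "w \<in> x \<theta>"
          using free_prof_rep[OF x(2) \<theta>(1)] by blast
        then have "w \<in> x \<eta>" "w \<in> y \<eta>"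
          using free_prof_mono[OF _ \<theta>(1) \<eta> sub] x y by auto
        then have "x \<eta> = y \<eta>"
          using free_prof_eq_Image[OF _ \<eta>] x(2) y(1) by metis
        then show ?thesis
          using W(2) \<eta> by (auto simp: PiE_iff)
      qed
      moreover have "y \<in> extensional ?I"
        using y(1) unfolding free_prof_def by (auto simp: PiE_iff)
      ultimately have "y \<in> Pi\<^sub>E ?I W"
        by (simp add: PiE_iff)
      then show ?thesis
        using W(3) by blast
    qed
    then show ?thesis
      using V(2) \<theta>(1) by blast
  qed
  then show ?R
    using V(2) by blast
next
  let ?I = "Collect (fin_cong :: ('a list \<times> 'a list) set \<Rightarrow> bool)"
  let ?X = "product_topology (\<lambda>\<theta>. discrete_topology (words // \<theta>)) ?I"
  assume R: ?R
  have "\<exists>V. openin free_prof_topology V \<and> x \<in> V \<and> V \<subseteq> U" if x: "x \<in> U" for x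
  proof -
    obtain \<theta> where \<theta>: "fin_cong \<theta>" "{y \<in> free_prof. y \<theta> = x \<theta>} \<subseteq> U"
      using R x by blast
    have xf: "x \<in> free_prof"
      using R x by blast
    have "continuous_map ?X (discrete_topology (words // \<theta>)) (\<lambda>x. x \<theta>)"
      using \<theta>(1) by (intro continuous_map_product_projection) simp
    then have "openin ?X {y \<in> topspace ?X. y \<theta> \<in> {x \<theta>}}"
      by (rule openin_continuous_map_preimage) (use free_prof_class[OF xf \<theta>(1)] in simp)
    then have "openin free_prof_topology (free_prof \<inter> {y \<in> topspace ?X. y \<theta> \<in> {x \<theta>}})"
      unfolding free_prof_topology_def by (rule openin_subtopology_Int2)
    moreover have "free_prof \<inter> {y \<in> topspace ?X. y \<theta> \<in> {x \<theta>}} = {y \<in> free_prof. y \<theta> = x \<theta>}"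
      unfolding free_prof_def by (auto simp: PiE_def)
    ultimately show ?thesis
      using \<theta> xf by (intro exI[of _ "{y \<in> free_prof. y \<theta> = x \<theta>}"]) auto
  qed
  then show "openin free_prof_topology U"
    by (subst openin_subopen) blast
qed

lemma closure_of_free_prof_topology:
  assumes "A \<subseteq> free_prof"
  shows "Abstract_Topology.closure_of free_prof_topology A =
    {x \<in> free_prof. \<forall>\<theta>. fin_cong \<theta> \<longrightarrow> (\<exists>a \<in> A. a \<theta> = x \<theta>)}"
proof (intro Set.set_eqI iffI)
  fix x assume x: "x \<in> Abstract_Topology.closure_of free_prof_topology A"
  then have xf: "x \<in> free_prof"
    by (simp add: in_closure_of)
  have "\<exists>a \<in> A. a \<theta> = x \<theta>" if "fin_cong \<theta>" for \<theta>
  proof -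
    have "openin free_prof_topology {y \<in> free_prof. y \<theta> = x \<theta>}"
      unfolding openin_free_prof_topology using that by auto
    then have "\<exists>y \<in> A. y \<in> {y \<in> free_prof. y \<theta> = x \<theta>}"
      using x xf unfolding in_closure_of by (metis (mono_tags, lifting) mem_Collect_eq)
    then show ?thesis by blast
  qed
  then show "x \<in> {x \<in> free_prof. \<forall>\<theta>. fin_cong \<theta> \<longrightarrow> (\<exists>a \<in> A. a \<theta> = x \<theta>)}"
    using xf by blast
next
  fix x assume x: "x \<in> {x \<in> free_prof. \<forall>\<theta>. fin_cong \<theta> \<longrightarrow> (\<exists>a \<in> A. a \<theta> = x \<theta>)}"
  have "\<exists>y. y \<in> A \<and> y \<in> U" if U: "x \<in> U" "openin free_prof_topology U" for U
  proof -
    obtain \<theta> where \<theta>: "fin_cong \<theta>" "{y \<in> free_prof. y \<theta> = x \<theta>} \<subseteq> U"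
      using iffD1[OF openin_free_prof_topology U(2)] U(1) by meson
    obtain a where "a \<in> A" "a \<theta> = x \<theta>"
      using x \<theta>(1) by blast
    then show ?thesis
      using assms \<theta>(2) by auto
  qed
  then show "x \<in> Abstract_Topology.closure_of free_prof_topology A"
    using x by (auto simp: in_closure_of)
qed

section \<open>Powers in finite quotients\<close>

abbreviation word_power :: "nat \<Rightarrow> 'a list \<Rightarrow> 'a list" where
  "word_power n w \<equiv> concat (replicate n w)"

lemma word_power_add: "word_power (m + n) w = word_power m w @ word_power n w"
  by (simp add: replicate_add)

lemma word_power_Suc_right: "word_power (Suc n) w = word_power n w @ w"
  using word_power_add[of n 1 w] by simp

lemma word_power_eventually_periodic:
  assumes "fin_cong \<theta>" "w \<noteq> []"
  obtains i p where "i \<ge> 1" "p \<ge> 1" "(word_power i w, word_power (i + p) w) \<in> \<theta>"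
proof -
  have "range (\<lambda>n. \<theta> `` {word_power (Suc n) w}) \<subseteq> words // \<theta>"
    using assms(2) by (auto simp: quotientI)
  then have "\<not> inj (\<lambda>n. \<theta> `` {word_power (Suc n) w})"
    using fin_cong_finite[OF assms(1)] finite_subset range_inj_infinite by blast
  then obtain i j where "i < j" "\<theta> `` {word_power (Suc i) w} = \<theta> `` {word_power (Suc j) w}"
    unfolding inj_def by (metis nat_neq_iff)
  then show thesis
    using that[of "Suc i" "j - i"] fin_cong_Image_eq[OF assms(1)] assms(2) by simp
qed

text \<open>Stability of finite semigroups. Iteration gives \<open>x\<close> congruent to
  \<open>s^n x y^n\<close>; as soon as \<open>s^i\<close> and \<open>s^(i+p)\<close> agree, the
  surplus \<open>s^p\<close> may be dropped on the left, which leaves \<open>y^p\<close> on the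
  right.\<close>

lemma fin_cong_stability:
  assumes \<theta>: "fin_cong \<theta>" and x: "(x, s @ x @ y) \<in> \<theta>" and ne: "s \<noteq> []"
  obtains p where "p \<ge> 1" "(x, x @ word_power p y) \<in> \<theta>"
proof -
  have pow: "(x, word_power n s @ x @ word_power n y) \<in> \<theta>" for n
  proof (induction n)
    case 0
    then show ?case
      using fin_cong_refl[OF \<theta>] fin_cong_nonempty[OF \<theta> x] by simp
  next
    case (Suc n)
    have "(word_power n s @ x @ word_power n y, word_power n s @ (s @ x @ y) @ word_power n y) \<in> \<theta>"
      by (intro fin_cong_prepend fin_cong_append \<theta> x)
    moreover have "word_power n s @ (s @ x @ y) @ word_power n y =
      word_power (Suc n) s @ x @ word_power (Suc n) y"
      by (subst word_power_Suc_right) simp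
    ultimately show ?case
      using fin_cong_trans[OF \<theta> Suc.IH] by (simp only:)
  qed
  obtain i p where p: "p \<ge> 1" "(word_power i s, word_power (i + p) s) \<in> \<theta>"
    using word_power_eventually_periodic[OF \<theta> ne] by metis
  let ?r = "x @ word_power (i + p) y"
  have "(word_power (i + p) s @ ?r, word_power i s @ ?r) \<in> \<theta>"
    by (intro fin_cong_append \<theta> fin_cong_sym[OF \<theta> p(2)])
  then have "(x, word_power i s @ ?r) \<in> \<theta>"
    using fin_cong_trans[OF \<theta> pow[of "i + p"]] by blast
  moreover have "((word_power i s @ x @ word_power i y) @ word_power p y, x @ word_power p y) \<in> \<theta>"
    by (intro fin_cong_append \<theta> fin_cong_sym[OF \<theta> pow])
  ultimately have "(x, x @ word_power p y) \<in> \<theta>"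
    using fin_cong_trans[OF \<theta>] by (simp add: word_power_add)
  with p(1) that show thesis by blast
qed

lemma split_cong_subset: "fin_cong \<theta> \<Longrightarrow> split_cong \<theta> \<subseteq> \<theta>"
  unfolding split_cong_def using fin_cong_Image_eq by fastforce

text \<open>A word shorter than \<open>N\<close> is alone in its class and hence not congruent to
  its square. Thus representatives of an idempotent can be forced to be as long as desired.\<close>

lemma idempotent_ends_cong_length:
  assumes "(w, w @ w) \<in> ends_cong N"
  shows "N \<le> length w"
proof (rule ccontr)
  assume "\<not> N \<le> length w"
  then have "length (take N w) < length (take N (w @ w))"
    using assms by (auto simp: ends_cong_def)
  then show False
    using assms by (auto simp: ends_cong_def)
qed

section \<open>The closure of a uniformly recurrent language\<close>

text \<open>The topological closure of the embedded words, in terms of representatives; see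
  \<open>closure_of_embed_word\<close>.\<close>

definition lang_closure :: "'a::finite list set \<Rightarrow> (('a list \<times> 'a list) set \<Rightarrow> 'a list set) set" where
  "lang_closure L = {x \<in> free_prof. \<forall>\<theta>. fin_cong \<theta> \<longrightarrow> (\<exists>w \<in> L. w \<in> x \<theta>)}"

text \<open>Cut out of the closure of the language instead of being defined through invertibility.
  That it is closed under products and inverses has to be proved, but membership can be tested on
  representatives.\<close>

definition local_group ::
  "'a::finite list set \<Rightarrow> (('a list \<times> 'a list) set \<Rightarrow> 'a list set) \<Rightarrow>
    (('a list \<times> 'a list) set \<Rightarrow> 'a list set) monoid" where
  "local_group L e =
     \<lparr>carrier = {x \<in> lang_closure L. e \<odot> x = x \<and> x \<odot> e = x}, mult = free_prof_mult, one = e\<rparr>"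

lemma lang_closure_free_prof: "x \<in> lang_closure L \<Longrightarrow> x \<in> free_prof"
  by (simp add: lang_closure_def)

lemma lang_closure_rep:
  assumes "x \<in> lang_closure L" "fin_cong \<theta>"
  obtains w where "w \<in> L" "w \<in> x \<theta>"
  using assms unfolding lang_closure_def by blast

lemma embed_word_free_prof:
  assumes "w \<noteq> []"
  shows "embed_word w \<in> free_prof"
  using assms unfolding free_prof_def embed_word_def by (auto simp: quotientI)

lemma mem_embed_word: "fin_cong \<theta> \<Longrightarrow> v \<in> embed_word w \<theta> \<longleftrightarrow> (w, v) \<in> \<theta>"
  by (simp add: embed_word_def)

lemma closure_of_embed_word:
  assumes "L \<subseteq> words"
  shows "Abstract_Topology.closure_of free_prof_topology (embed_word ` L) = lang_closure L"
proof -
  have sub: "embed_word ` L \<subseteq> free_prof"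
    using assms embed_word_free_prof by (metis image_subsetI subsetD words_iff)
  have "(\<exists>a \<in> embed_word ` L. a \<theta> = x \<theta>) \<longleftrightarrow> (\<exists>w \<in> L. w \<in> x \<theta>)"
    if "x \<in> free_prof" "fin_cong \<theta>" for x \<theta>
  proof -
    have "embed_word w \<theta> = x \<theta> \<longleftrightarrow> w \<in> x \<theta>" if "w \<in> L" for w
    proof -
      have "(w, w) \<in> \<theta>"
        using that assms fin_cong_refl[OF \<open>fin_cong \<theta>\<close>] by auto
      then show ?thesis
        using free_prof_eq_Image[OF \<open>x \<in> free_prof\<close> \<open>fin_cong \<theta>\<close>, of w] \<open>fin_cong \<theta>\<close>
        by (auto simp: embed_word_def)
    qed
    then show ?thesis by auto
  qed
  then show ?thesis
    unfolding closure_of_free_prof_topology[OF sub] lang_closure_def by auto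
qed

lemma free_prof_mult_eqI:
  assumes "x \<in> free_prof" "y \<in> free_prof" "z \<in> free_prof"
    and "\<And>\<theta>. fin_cong \<theta> \<Longrightarrow> \<exists>u \<in> x \<theta>. \<exists>v \<in> y \<theta>. u @ v \<in> z \<theta>"
  shows "x \<odot> y = z"
  using assms free_prof_mult_rep by (intro free_prof_eqI) blast+

text \<open>Factor closure and uniform recurrence are all that the theory of the maximal subgroups
  uses; the substitution enters only afterwards.\<close>

locale recurrent_language =
  fixes L :: "'a::finite list set"
  assumes nonempty: "[] \<notin> L"
    and factor: "\<lbrakk>u @ v @ w \<in> L; v \<noteq> []\<rbrakk> \<Longrightarrow> v \<in> L"
    and recurrent: "u \<in> L \<Longrightarrow> \<exists>N. \<forall>w \<in> L. N \<le> length w \<longrightarrow> sublist u w"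
begin

text \<open>A word of the language that represents \<open>x \<odot> y\<close> modulo
  \<open>split_cong \<theta>\<close> can be cut into representatives of \<open>x\<close> and
  \<open>y\<close> modulo \<open>\<theta>\<close>, and factors of words of the language stay in the
  language.\<close>

lemma lang_closure_factor:
  assumes x: "x \<in> free_prof" and y: "y \<in> free_prof" and xy: "x \<odot> y \<in> lang_closure L"
  shows "x \<in> lang_closure L" "y \<in> lang_closure L"
proof -
  have "(\<exists>w \<in> L. w \<in> x \<theta>) \<and> (\<exists>w \<in> L. w \<in> y \<theta>)" if \<theta>: "fin_cong \<theta>" for \<theta>
  proof -
    note \<eta> = fin_cong_split_cong[OF \<theta>]
    obtain w where w: "w \<in> L" "w \<in> (x \<odot> y) (split_cong \<theta>)"
      using lang_closure_rep[OF xy \<eta>] by blast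
    obtain p q where pq: "p \<in> x (split_cong \<theta>)" "q \<in> y (split_cong \<theta>)"
      using free_prof_rep[OF x \<eta>] free_prof_rep[OF y \<eta>] by metis
    then have ne: "p \<noteq> []" "q \<noteq> []"
      using free_prof_nonempty x y \<eta> by blast+
    have "(p @ q, w) \<in> split_cong \<theta>"
      using free_prof_mult_rep[OF x y \<eta> pq] free_prof_rel[OF _ \<eta>] w(2) x y
      by (meson free_prof_mult_closed)
    then obtain p' q' where w': "w = p' @ q'" "(p, p') \<in> \<theta>" "(q, q') \<in> \<theta>"
      using split_congD[OF \<theta> _ ne] by blast
    have "p' \<in> x \<theta>" "q' \<in> y \<theta>"
      using free_prof_mono[OF _ \<eta> \<theta> split_cong_subset[OF \<theta>]] pq x y w' free_prof_rel[OF _ \<theta>]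
      by blast+
    moreover have "p' \<in> L" "q' \<in> L"
      using factor[of "[]" p' q'] factor[of p' q' "[]"] w w' fin_cong_nonempty[OF \<theta>] by auto
    ultimately show ?thesis by blast
  qed
  then show "x \<in> lang_closure L" "y \<in> lang_closure L"
    using x y unfolding lang_closure_def by auto
qed

text \<open>Modulo a suitable \<open>ends_cong\<close> the representatives of \<open>e\<close> are
  so long that uniform recurrence makes \<open>u\<close> occur in them. So \<open>e\<close> lies
  below every word of the language in the order of factors.\<close>

lemma idempotent_contains_word:
  assumes e: "e \<in> lang_closure L" "e \<odot> e = e" and u: "u \<in> L" and \<theta>: "fin_cong \<theta>"
  obtains s t where "s @ u @ t \<in> e \<theta>"
proof -
  obtain N where N: "\<And>w. w \<in> L \<Longrightarrow> N \<le> length w \<Longrightarrow> sublist u w"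
    using recurrent[OF u] by blast
  note ef = lang_closure_free_prof[OF e(1)]
  have \<eta>: "fin_cong (\<theta> \<inter> ends_cong N)"
    by (intro fin_cong_Int \<theta> fin_cong_ends_cong)
  obtain w where w: "w \<in> L" "w \<in> e (\<theta> \<inter> ends_cong N)"
    using lang_closure_rep[OF e(1) \<eta>] by blast
  have "w @ w \<in> e (\<theta> \<inter> ends_cong N)"
    using free_prof_mult_rep[OF ef ef \<eta> w(2) w(2)] e(2) by simp
  then have "(w, w @ w) \<in> ends_cong N"
    using free_prof_rel[OF ef \<eta> w(2)] by blast
  then have "sublist u w"
    using N w(1) idempotent_ends_cong_length by blast
  moreover have "w \<in> e \<theta>"
    using free_prof_mono[OF ef \<eta> \<theta>] w(2) by blast
  ultimately show thesis
    using that unfolding sublist_def by blast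
qed

text \<open>At each congruence a representative \<open>u\<close> of \<open>x\<close> occurs in a
  representative \<open>w\<close> of \<open>e\<close>. Stability removes what stands to the left of
  \<open>u\<close>, so \<open>e\<close> becomes a right multiple of \<open>x\<close>; compactness
  turns the local solutions into one element.\<close>

lemma right_inverse:
  assumes e: "e \<in> lang_closure L" "e \<odot> e = e"
    and x: "x \<in> lang_closure L" "e \<odot> x = x" "x \<odot> e = x"
  obtains y where "y \<in> free_prof" "x \<odot> y = e"
proof -
  note ef = lang_closure_free_prof[OF e(1)]
  note xf = lang_closure_free_prof[OF x(1)]
  have "\<exists>y \<in> free_prof. \<forall>\<theta>. fin_cong \<theta> \<longrightarrow> (\<exists>u \<in> x \<theta>. \<exists>v \<in> y \<theta>. u @ v \<in> e \<theta>)"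
  proof (rule free_prof_compactness)
    fix \<theta> \<eta> :: "('a list \<times> 'a list) set" and C D
    assume "fin_cong \<theta>" "fin_cong \<eta>" "\<theta> \<subseteq> \<eta>" "C \<subseteq> D" "\<exists>u \<in> x \<theta>. \<exists>v \<in> C. u @ v \<in> e \<theta>"
    then show "\<exists>u \<in> x \<eta>. \<exists>v \<in> D. u @ v \<in> e \<eta>"
      using free_prof_mono[OF xf] free_prof_mono[OF ef] by blast
  next
    fix \<theta> :: "('a list \<times> 'a list) set"
    assume \<theta>: "fin_cong \<theta>"
    obtain u where u: "u \<in> L" "u \<in> x \<theta>"
      using lang_closure_rep[OF x(1) \<theta>] by blast
    obtain s t where w: "s @ u @ t \<in> e \<theta>"
      using idempotent_contains_word[OF e u(1) \<theta>] by blast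
    let ?w = "s @ u @ t"
    let ?y = "u @ t @ ?w"
    have ee: "a @ b \<in> e \<theta>" if "a \<in> e \<theta>" "b \<in> e \<theta>" for a b
      using free_prof_mult_rep[OF ef ef \<theta> that] e(2) by simp
    have "?w @ u \<in> x \<theta>"
      using free_prof_mult_rep[OF ef xf \<theta> w u(2)] by (simp only: x(2))
    then have wu: "(?w @ u, u) \<in> \<theta>"
      using free_prof_rel[OF xf \<theta>] u(2) by blast
    \<comment> \<open>Since \<open>e \<odot> x = x\<close>, the middle factor \<open>u\<close> of
      \<open>w w w\<close> may be replaced by \<open>w u\<close>. This makes \<open>w\<close> itself
      reappear inside a product congruent to \<open>w\<close>, which is the situation of
      \<open>fin_cong_stability\<close>.\<close>
    have "(?w @ s @ (?w @ u) @ t @ ?w, ?w @ s @ u @ t @ ?w) \<in> \<theta>"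
      by (intro fin_cong_prepend fin_cong_append \<theta> wu)
    moreover have "?w @ s @ u @ t @ ?w \<in> e \<theta>"
      using ee[OF w ee[OF w w]] by simp
    ultimately have "?w @ s @ (?w @ u) @ t @ ?w \<in> e \<theta>"
      using free_prof_rel[OF ef \<theta>] fin_cong_sym[OF \<theta>] by blast
    then have "(?w, (?w @ s) @ ?w @ ?y) \<in> \<theta>"
      using free_prof_rel[OF ef \<theta> w] by simp
    moreover have "?w @ s \<noteq> []"
      using free_prof_nonempty[OF ef \<theta> w] by auto
    ultimately obtain p where p: "p \<ge> 1" "(?w, ?w @ word_power p ?y) \<in> \<theta>"
      using fin_cong_stability[OF \<theta>] by blast
    let ?v = "t @ ?w @ word_power (p - 1) ?y"
    have y: "word_power p ?y = u @ ?v"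
      using p(1) by (cases p) auto
    \<comment> \<open>The power of \<open>?y\<close> begins with \<open>u\<close>, which absorbs the
      \<open>w\<close> in front of it.\<close>
    have "(?w @ u @ ?v, u @ ?v) \<in> \<theta>"
      using fin_cong_append[OF \<theta> wu, of ?v] by simp
    then have "(?w, u @ ?v) \<in> \<theta>"
      using p(2) fin_cong_trans[OF \<theta>] unfolding y by blast
    then have uv: "u @ ?v \<in> e \<theta>"
      using free_prof_rel[OF ef \<theta> w] by simp
    have v: "?v \<noteq> []"
      using free_prof_nonempty[OF ef \<theta> w] by auto
    show "\<exists>C \<in> words // \<theta>. \<exists>u \<in> x \<theta>. \<exists>v \<in> C. u @ v \<in> e \<theta>"
    proof (intro bexI)
      show "\<theta> `` {?v} \<in> words // \<theta>"
        by (rule quotientI) (simp only: words_iff v not_False_eq_True)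
      show "?v \<in> \<theta> `` {?v}"
        using fin_cong_refl[OF \<theta> v] by simp
    qed (fact uv u(2))+
  qed
  then show thesis
    using that free_prof_mult_eqI[OF xf _ ef] by metis
qed

text \<open>A product \<open>x \<odot> y\<close> is a left factor of \<open>e\<close>, because
  multiplying it by the right inverses of \<open>y\<close> and \<open>x\<close> gives
  \<open>e\<close>; hence it stays in the closure. Right inverses are two-sided, as \<open>x\<close>
  is itself the right inverse of its right inverse.\<close>

lemma group_local_group:
  assumes e: "e \<in> lang_closure L" "e \<odot> e = e"
  shows "group (local_group L e)"
proof (rule groupI)
  let ?G = "local_group L e"
  note ef = lang_closure_free_prof[OF e(1)]
  have carrier: "x \<in> carrier ?G \<longleftrightarrow> x \<in> lang_closure L \<and> e \<odot> x = x \<and> x \<odot> e = x" for x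
    by (simp add: local_group_def)
  have [simp]: "mult ?G = (\<odot>)" "one ?G = e"
    by (simp_all add: local_group_def)
  have G_free: "x \<in> free_prof" if "x \<in> carrier ?G" for x
    using that carrier lang_closure_free_prof by blast
  have inv: "\<exists>y \<in> carrier ?G. x \<odot> y = e" if "x \<in> carrier ?G" for x
  proof -
    note x = that[unfolded carrier] and xf = G_free[OF that]
    obtain y where y: "y \<in> free_prof" "x \<odot> y = e"
      using right_inverse[OF e] x by blast
    \<comment> \<open>The right inverse found by compactness need not be fixed by \<open>e\<close>;
      multiplying by \<open>e\<close> on both sides repairs this.\<close>
    let ?y = "e \<odot> y \<odot> e"
    have "x \<odot> ?y = x \<odot> e \<odot> y \<odot> e"
      using xf y(1) ef by (simp add: free_prof_mult_assoc)
    then have xy: "x \<odot> ?y = e"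
      using x y e by simp
    have "?y \<in> lang_closure L"
      by (rule lang_closure_factor(2)[OF xf]) (use y(1) ef xy e(1) in simp_all)
    moreover have "e \<odot> ?y = ?y" "?y \<odot> e = ?y"
      using y(1) ef e(2) by (simp_all add: free_prof_mult_assoc)
        (simp flip: free_prof_mult_assoc add: e(2))
    ultimately show ?thesis
      using xy carrier by blast
  qed
  show "\<one>\<^bsub>?G\<^esub> \<in> carrier ?G"
    using e carrier by simp
  fix x y assume xy: "x \<in> carrier ?G" "y \<in> carrier ?G"
  obtain x' y' where x': "x' \<in> carrier ?G" "x \<odot> x' = e" and y': "y' \<in> carrier ?G" "y \<odot> y' = e"
    using inv xy by metis
  note free = G_free[OF xy(1)] G_free[OF xy(2)] G_free[OF x'(1)] G_free[OF y'(1)] ef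
  have "(x \<odot> y) \<odot> (y' \<odot> x') = x \<odot> (y \<odot> y') \<odot> x'"
    using free by (simp add: free_prof_mult_assoc)
  then have "(x \<odot> y) \<odot> (y' \<odot> x') \<in> lang_closure L"
    using xy x' y' e carrier by simp
  then have "x \<odot> y \<in> lang_closure L"
    using lang_closure_factor(1) free by blast
  moreover have "e \<odot> (x \<odot> y) = x \<odot> y" "x \<odot> y \<odot> e = x \<odot> y"
    using free xy carrier by (simp_all flip: free_prof_mult_assoc) (simp add: free_prof_mult_assoc)
  ultimately show "x \<otimes>\<^bsub>?G\<^esub> y \<in> carrier ?G"
    using carrier by simp
  show "\<one>\<^bsub>?G\<^esub> \<otimes>\<^bsub>?G\<^esub> x = x"
    using xy carrier by simp
  show "x \<otimes>\<^bsub>?G\<^esub> y \<otimes>\<^bsub>?G\<^esub> z = x \<otimes>\<^bsub>?G\<^esub> (y \<otimes>\<^bsub>?G\<^esub> z)" if "z \<in> carrier ?G" for z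
    using free_prof_mult_assoc[OF G_free[OF xy(1)] G_free[OF xy(2)] G_free[OF that]] by simp
  obtain z where z: "z \<in> carrier ?G" "x' \<odot> z = e"
    using inv x' by blast
  have "x = x \<odot> (x' \<odot> z)"
    using z xy carrier by simp
  also have "\<dots> = z"
    using z x' xy carrier G_free free_prof_mult_assoc by metis
  finally show "\<exists>y \<in> carrier ?G. y \<otimes>\<^bsub>?G\<^esub> x = \<one>\<^bsub>?G\<^esub>"
    using z x' by auto
qed

text \<open>A larger group contains the idempotent \<open>e\<close>, which must then be its
  identity. Each of its elements is a left factor of \<open>e\<close> and so belongs to the
  closure.\<close>

lemma maximal_subgroup_local_group:
  assumes e: "e \<in> lang_closure L" "e \<odot> e = e"
  shows "maximal_subgroup free_prof (\<odot>) (local_group L e)"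
  unfolding maximal_subgroup_def
proof (intro conjI allI impI)
  let ?G = "local_group L e"
  show "semigroup_subgroup free_prof (\<odot>) ?G"
    using group_local_group[OF e] lang_closure_free_prof
    by (auto simp: semigroup_subgroup_def local_group_def)
  fix H assume H: "semigroup_subgroup free_prof (\<odot>) H" and sub: "carrier ?G \<subseteq> carrier H"
  then interpret H: group H
    by (simp add: semigroup_subgroup_def)
  have mult: "mult H = (\<odot>)" and H_free: "carrier H \<subseteq> free_prof"
    using H by (auto simp: semigroup_subgroup_def)
  have eH: "e \<in> carrier H"
    using e sub by (auto simp: local_group_def)
  then have one: "\<one>\<^bsub>H\<^esub> = e"
    using e(2) H.r_cancel_one[OF eH eH] mult by simp
  have "x \<in> carrier ?G" if x: "x \<in> carrier H" for x
  proof -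
    have "x \<odot> inv\<^bsub>H\<^esub> x = e"
      using H.r_inv[OF x] mult one by simp
    then have "x \<in> lang_closure L"
      using lang_closure_factor(1)[of x "inv\<^bsub>H\<^esub> x"] H_free x e(1) by auto
    then show ?thesis
      using H.l_one[OF x] H.r_one[OF x] mult one by (simp add: local_group_def)
  qed
  then show "carrier H = carrier ?G"
    using sub by blast
qed

lemma maximal_subgroup_is_local_group:
  assumes G: "maximal_subgroup free_prof (\<odot>) G" and sub: "carrier G \<subseteq> lang_closure L"
  obtains e where "e \<in> lang_closure L" "e \<odot> e = e" "G = local_group L e"
proof -
  have S: "semigroup_subgroup free_prof (\<odot>) G"
    using G by (simp add: maximal_subgroup_def)
  then interpret group G
    by (simp add: semigroup_subgroup_def)
  have mult: "mult G = (\<odot>)"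
    using S by (simp add: semigroup_subgroup_def)
  let ?e = "\<one>\<^bsub>G\<^esub>"
  have e: "?e \<in> lang_closure L" "?e \<odot> ?e = ?e"
    using sub l_one[OF one_closed] mult by auto
  have "carrier G \<subseteq> carrier (local_group L ?e)"
    using sub l_one r_one mult by (auto simp: local_group_def)
  moreover have "semigroup_subgroup free_prof (\<odot>) (local_group L ?e)"
    using maximal_subgroup_local_group[OF e] by (simp add: maximal_subgroup_def)
  ultimately have "carrier (local_group L ?e) = carrier G"
    using G by (simp add: maximal_subgroup_def)
  then have "G = local_group L ?e"
    using mult by (simp add: local_group_def)
  with e that show thesis by blast
qed

text \<open>A finite word cannot absorb a nonempty word on the left, and \<open>ends_cong\<close>
  with a bound above its length detects this.\<close>

lemma local_group_disjoint_words:
  assumes e: "e \<in> lang_closure L" and x: "x \<in> carrier (local_group L e)"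
  shows "x \<notin> embed_word ` L"
proof
  assume "x \<in> embed_word ` L"
  then obtain w where w: "w \<in> L" "x = embed_word w" by blast
  let ?\<theta> = "ends_cong (Suc (length w)) :: ('a list \<times> 'a list) set"
  note \<theta> = fin_cong_ends_cong[of "Suc (length w)", where 'a = 'a]
  note ef = lang_closure_free_prof[OF e(1)]
  have xf: "x \<in> free_prof" and ex: "e \<odot> x = x"
    using x lang_closure_free_prof by (auto simp: local_group_def)
  obtain v where v: "v \<in> e ?\<theta>" "v \<noteq> []"
    using free_prof_rep[OF ef \<theta>] by blast
  have wx: "w \<in> x ?\<theta>"
    using w nonempty by (metis mem_embed_word[OF \<theta>] fin_cong_refl[OF \<theta>])
  have "(w, v @ w) \<in> ?\<theta>"
    using free_prof_mult_rep[OF ef xf \<theta> v(1) wx] ex free_prof_rel[OF xf \<theta> wx] by simp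
  then have "length (take (Suc (length w)) w) = length (take (Suc (length w)) (v @ w))"
    by (simp add: ends_cong_def)
  then show False
    using v(2) by (cases v) auto
qed

text \<open>Representatives of \<open>f\<close> in the language occur in representatives of
  \<open>e\<close>, so \<open>e\<close> factors through \<open>f\<close>. Two such idempotents are
  conjugate, as in a finite semigroup.\<close>

lemma idempotents_conjugate:
  assumes e: "e \<in> lang_closure L" "e \<odot> e = e" and f: "f \<in> lang_closure L" "f \<odot> f = f"
  obtains s t where "s \<in> free_prof" "t \<in> free_prof" "e \<odot> s = s" "s \<odot> f = s" "f \<odot> t = t" "t \<odot> e = t"
    "s \<odot> t = e" "t \<odot> s = f"
proof -
  note ef = lang_closure_free_prof[OF e(1)] and ff = lang_closure_free_prof[OF f(1)]
  have stage: "\<exists>w \<in> e \<theta>. \<exists>u \<in> f \<theta>. \<exists>p q. p \<noteq> [] \<and> q \<noteq> [] \<and> (w, p @ u @ q) \<in> \<theta>"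
    if \<theta>: "fin_cong \<theta>" for \<theta>
  proof -
    obtain u where u: "u \<in> L" "u \<in> f \<theta>"
      using lang_closure_rep[OF f(1) \<theta>] by blast
    obtain p q where w: "p @ u @ q \<in> e \<theta>"
      using idempotent_contains_word[OF e u(1) \<theta>] by blast
    let ?w = "p @ u @ q"
    \<comment> \<open>The factors around \<open>u\<close> may be empty, but the inverse limit has no
      empty word. Tripling the representative makes both nonempty.\<close>
    have "?w @ ?w @ ?w \<in> e \<theta>"
      using free_prof_mult_rep[OF ef ef \<theta> w] free_prof_mult_rep[OF ef ef \<theta> w w] e(2) by metis
    then have "(?w, (?w @ p) @ u @ (q @ ?w)) \<in> \<theta>"
      using free_prof_rel[OF ef \<theta> w] by simp
    moreover have "?w @ p \<noteq> []" "q @ ?w \<noteq> []"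
      using free_prof_nonempty[OF ef \<theta> w] by auto
    ultimately have "\<exists>p' q'. p' \<noteq> [] \<and> q' \<noteq> [] \<and> (?w, p' @ u @ q') \<in> \<theta>"
      by (intro exI[of _ "?w @ p"] exI[of _ "q @ ?w"] conjI)
    then show ?thesis
      using w u(2) by (intro bexI)
  qed
  have cl: "\<exists>C \<in> words // \<theta>. p \<in> C" if "fin_cong \<theta>" "p \<noteq> []" for \<theta> and p :: "'a list"
    using that fin_cong_refl[OF that] by (intro bexI[of _ "\<theta> `` {p}"]) (auto simp: quotientI)
  \<comment> \<open>Compactness yields one element at a time. The left factor is fixed first, with
    only the existence of some right factor at each congruence; the second application then fixes
    the right factor.\<close>
  have "\<exists>s \<in> free_prof. \<forall>\<theta>. fin_cong \<theta> \<longrightarrow>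
    (\<exists>w \<in> e \<theta>. \<exists>u \<in> f \<theta>. \<exists>p \<in> s \<theta>. \<exists>q. q \<noteq> [] \<and> (w, p @ u @ q) \<in> \<theta>)"
  proof (rule free_prof_compactness)
    show "\<exists>C \<in> words // \<theta>. \<exists>w \<in> e \<theta>. \<exists>u \<in> f \<theta>. \<exists>p \<in> C. \<exists>q. q \<noteq> [] \<and> (w, p @ u @ q) \<in> \<theta>"
      if "fin_cong \<theta>" for \<theta>
      using stage[OF that] cl[OF that] by meson
    fix \<theta> \<eta> :: "('a list \<times> 'a list) set" and C D
    assume "fin_cong \<theta>" "fin_cong \<eta>" "\<theta> \<subseteq> \<eta>" "C \<subseteq> D"
      "\<exists>w \<in> e \<theta>. \<exists>u \<in> f \<theta>. \<exists>p \<in> C. \<exists>q. q \<noteq> [] \<and> (w, p @ u @ q) \<in> \<theta>"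
    then show "\<exists>w \<in> e \<eta>. \<exists>u \<in> f \<eta>. \<exists>p \<in> D. \<exists>q. q \<noteq> [] \<and> (w, p @ u @ q) \<in> \<eta>"
      using free_prof_mono[OF ef] free_prof_mono[OF ff] by (meson subsetD)
  qed
  then obtain s0 where s0: "s0 \<in> free_prof"
    "\<And>\<theta>. fin_cong \<theta> \<Longrightarrow> \<exists>w \<in> e \<theta>. \<exists>u \<in> f \<theta>. \<exists>p \<in> s0 \<theta>. \<exists>q. q \<noteq> [] \<and> (w, p @ u @ q) \<in> \<theta>"
    by blast
  have "\<exists>t \<in> free_prof. \<forall>\<theta>. fin_cong \<theta> \<longrightarrow>
    (\<exists>w \<in> e \<theta>. \<exists>u \<in> f \<theta>. \<exists>p \<in> s0 \<theta>. \<exists>q \<in> t \<theta>. (w, p @ u @ q) \<in> \<theta>)"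
  proof (rule free_prof_compactness)
    show "\<exists>C \<in> words // \<theta>. \<exists>w \<in> e \<theta>. \<exists>u \<in> f \<theta>. \<exists>p \<in> s0 \<theta>. \<exists>q \<in> C. (w, p @ u @ q) \<in> \<theta>"
      if "fin_cong \<theta>" for \<theta>
      using s0(2)[OF that] cl[OF that] by meson
    fix \<theta> \<eta> :: "('a list \<times> 'a list) set" and C D
    assume "fin_cong \<theta>" "fin_cong \<eta>" "\<theta> \<subseteq> \<eta>" "C \<subseteq> D"
      "\<exists>w \<in> e \<theta>. \<exists>u \<in> f \<theta>. \<exists>p \<in> s0 \<theta>. \<exists>q \<in> C. (w, p @ u @ q) \<in> \<theta>"
    then show "\<exists>w \<in> e \<eta>. \<exists>u \<in> f \<eta>. \<exists>p \<in> s0 \<eta>. \<exists>q \<in> D. (w, p @ u @ q) \<in> \<eta>"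
      using free_prof_mono[OF ef] free_prof_mono[OF ff] free_prof_mono[OF s0(1)] by (meson subsetD)
  qed
  then obtain t0 where t0: "t0 \<in> free_prof"
    "\<And>\<theta>. fin_cong \<theta> \<Longrightarrow> \<exists>w \<in> e \<theta>. \<exists>u \<in> f \<theta>. \<exists>p \<in> s0 \<theta>. \<exists>q \<in> t0 \<theta>. (w, p @ u @ q) \<in> \<theta>"
    by blast
  have e_eq: "s0 \<odot> (f \<odot> t0) = e"
  proof (rule free_prof_mult_eqI)
    fix \<theta> :: "('a list \<times> 'a list) set" assume \<theta>: "fin_cong \<theta>"
    then obtain w u p q where "w \<in> e \<theta>" "u \<in> f \<theta>" "p \<in> s0 \<theta>" "q \<in> t0 \<theta>" "(w, p @ u @ q) \<in> \<theta>"
      using t0(2) by blast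
    then show "\<exists>u \<in> s0 \<theta>. \<exists>v \<in> (f \<odot> t0) \<theta>. u @ v \<in> e \<theta>"
      using free_prof_mult_rep[OF ff t0(1) \<theta>] free_prof_rel[OF ef \<theta>] by blast
  qed (use s0(1) t0(1) ef ff in auto)
  define s where "s = e \<odot> s0 \<odot> f"
  define t where "t = f \<odot> t0 \<odot> e"
  have free: "s \<in> free_prof" "t \<in> free_prof"
    using s0(1) t0(1) ef ff by (auto simp: s_def t_def)
  note assoc = free_prof_mult_assoc
  have es: "e \<odot> s = s" and sf: "s \<odot> f = s" and ft: "f \<odot> t = t" and te: "t \<odot> e = t"
    using e(2) f(2) s0(1) t0(1) ef ff by (simp_all add: s_def t_def assoc)
      (simp_all flip: assoc add: e(2) f(2))
  have "s \<odot> t = e \<odot> s0 \<odot> (f \<odot> f) \<odot> t0 \<odot> e"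
    using s0(1) t0(1) ef ff by (simp add: s_def t_def assoc del: f(2))
  also have "\<dots> = e \<odot> (s0 \<odot> (f \<odot> t0)) \<odot> e"
    using s0(1) t0(1) ef ff f(2) by (simp add: assoc)
  finally have st: "s \<odot> t = e"
    using e_eq e(2) by simp
  \<comment> \<open>Here \<open>t \<odot> s\<close> is a factor of
    \<open>(s \<odot> t) \<odot> (s \<odot> t) = e\<close>, so it lies in the closure. It belongs to
    the group at \<open>f\<close> and is idempotent, hence it equals \<open>f\<close>.\<close>
  have "s \<odot> (t \<odot> s \<odot> t) = (s \<odot> t) \<odot> (s \<odot> t)"
    using free by (simp add: assoc)
  then have "s \<odot> (t \<odot> s \<odot> t) \<in> lang_closure L"
    using st e by simp
  then have "t \<odot> s \<odot> t \<in> lang_closure L"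
    using lang_closure_factor(2) free by blast
  then have "t \<odot> s \<in> lang_closure L"
    using lang_closure_factor(1) free by blast
  then have ts: "t \<odot> s \<in> carrier (local_group L f)"
    using free ff sf ft by (simp add: local_group_def assoc) (simp flip: assoc)
  interpret F: group "local_group L f"
    by (rule group_local_group[OF f])
  have "t \<odot> s \<odot> (t \<odot> s) = t \<odot> (s \<odot> t) \<odot> s"
    using free by (simp add: assoc)
  also have "\<dots> = t \<odot> s"
    using st te by simp
  finally have "t \<odot> s \<otimes>\<^bsub>local_group L f\<^esub> (t \<odot> s) = t \<odot> s"
    by (simp add: local_group_def)
  then have "t \<odot> s = \<one>\<^bsub>local_group L f\<^esub>"
    using F.r_cancel_one[OF ts ts] by simp
  then have "t \<odot> s = f"
    by (simp add: local_group_def)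
  with that free es sf ft te st show thesis by blast
qed

lemma local_groups_iso:
  assumes e: "e \<in> lang_closure L" "e \<odot> e = e" and f: "f \<in> lang_closure L" "f \<odot> f = f"
  shows "\<exists>s \<in> free_prof. \<exists>t \<in> free_prof.
    (\<lambda>x. s \<odot> x \<odot> t) \<in> hom (local_group L f) (local_group L e) \<and>
    (\<lambda>x. t \<odot> x \<odot> s) \<in> hom (local_group L e) (local_group L f) \<and>
    (\<forall>x \<in> carrier (local_group L f). t \<odot> (s \<odot> x \<odot> t) \<odot> s = x) \<and>
    (\<forall>x \<in> carrier (local_group L e). s \<odot> (t \<odot> x \<odot> s) \<odot> t = x)"
proof -
  note assoc = free_prof_mult_assoc
  have inverse: "t \<odot> (s \<odot> x \<odot> t) \<odot> s = x"
    if "s \<in> free_prof" "t \<in> free_prof" "t \<odot> s = f" "x \<in> carrier (local_group L f)" for s t f x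
  proof -
    have x: "x \<in> free_prof" "f \<odot> x = x" "x \<odot> f = x"
      using that lang_closure_free_prof by (auto simp: local_group_def)
    have "t \<odot> (s \<odot> x \<odot> t) \<odot> s = (t \<odot> s) \<odot> x \<odot> (t \<odot> s)"
      using that(1,2) x(1) by (simp add: assoc)
    then show ?thesis
      using that(3) x by simp
  qed
  have hom: "(\<lambda>x. s \<odot> x \<odot> t) \<in> hom (local_group L f) (local_group L e)"
    if st: "s \<in> free_prof" "t \<in> free_prof" "e \<odot> s = s" "t \<odot> e = t" "t \<odot> s = f"
      and ef: "e \<in> free_prof" for s t e f
  proof (rule homI)
    fix x assume "x \<in> carrier (local_group L f)"
    then have x: "x \<in> free_prof" "x \<in> lang_closure L" "f \<odot> x = x" "x \<odot> f = x"
      using lang_closure_free_prof by (auto simp: local_group_def)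
    \<comment> \<open>Conjugating back gives \<open>x\<close>, so
      \<open>s \<odot> x \<odot> t\<close> is a factor of an element of the closure.\<close>
    have "t \<odot> (s \<odot> x \<odot> t) \<odot> s \<in> lang_closure L"
      using inverse[OF st(1,2,5) \<open>x \<in> carrier (local_group L f)\<close>] x(2) by simp
    then have "t \<odot> (s \<odot> x \<odot> t) \<in> lang_closure L"
      by (rule lang_closure_factor(1)[rotated 2]) (use st x in simp_all)
    then have "s \<odot> x \<odot> t \<in> lang_closure L"
      by (rule lang_closure_factor(2)[rotated 2]) (use st x in simp_all)
    moreover have "e \<odot> (s \<odot> x \<odot> t) = e \<odot> s \<odot> x \<odot> t" "s \<odot> x \<odot> t \<odot> e = s \<odot> x \<odot> (t \<odot> e)"
      using st(1,2) x(1) ef by (simp_all add: assoc)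
    ultimately show "s \<odot> x \<odot> t \<in> carrier (local_group L e)"
      using st by (simp add: local_group_def)
    fix y assume "y \<in> carrier (local_group L f)"
    then have y: "y \<in> free_prof" "f \<odot> y = y"
      using lang_closure_free_prof by (auto simp: local_group_def)
    have "(s \<odot> x \<odot> t) \<odot> (s \<odot> y \<odot> t) = s \<odot> x \<odot> ((t \<odot> s) \<odot> y) \<odot> t"
      using st(1,2) x(1) y(1) by (simp add: assoc)
    also have "\<dots> = s \<odot> (x \<odot> y) \<odot> t"
      using st x(1) y by (simp add: assoc)
    finally show "s \<odot> (x \<otimes>\<^bsub>local_group L f\<^esub> y) \<odot> t =
      (s \<odot> x \<odot> t) \<otimes>\<^bsub>local_group L e\<^esub> (s \<odot> y \<odot> t)"
      by (simp add: local_group_def)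
  qed
  obtain s t where st: "s \<in> free_prof" "t \<in> free_prof" "e \<odot> s = s" "s \<odot> f = s"
    "f \<odot> t = t" "t \<odot> e = t" "s \<odot> t = e" "t \<odot> s = f"
    by (rule idempotents_conjugate[OF e f])
  show ?thesis
    by (intro bexI[OF _ st(1)] bexI[OF _ st(2)] conjI ballI
        hom[OF st(1,2,3,6,8) lang_closure_free_prof[OF e(1)]]
        hom[OF st(2,1,5,4,7) lang_closure_free_prof[OF f(1)]]
        inverse[OF st(1,2,8)] inverse[OF st(2,1,7)])
qed

end

section \<open>Factors of Thue-Morse words\<close>

abbreviation tm :: "letter list \<Rightarrow> letter list" where
  "tm \<equiv> subst_word thue_morse"

abbreviation tm_language :: "letter list set" where
  "tm_language \<equiv> subst_language thue_morse"

lemma tm_simps [simp]: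
  "tm [] = []" "tm (c # w) = thue_morse c @ tm w" "tm (u @ v) = tm u @ tm v"
  by (simp_all add: subst_word_def)

lemma length_thue_morse [simp]: "length (thue_morse c) = 2"
  by (cases c) auto

lemma length_tm [simp]: "length (tm w) = 2 * length w"
  by (induction w) auto

lemma tm_funpow_append [simp]: "(tm ^^ k) (u @ v) = (tm ^^ k) u @ (tm ^^ k) v"
  by (induction k) auto

lemma tm_funpow_Cons: "w \<noteq> [] \<Longrightarrow> (tm ^^ k) (c # w) = (tm ^^ k) [c] @ (tm ^^ k) w"
  using tm_funpow_append[of k "[c]" w] by simp

lemma length_tm_funpow [simp]: "length ((tm ^^ k) w) = 2 ^ k * length w"
  by (induction k) auto

lemma tm_funpow_Nil_iff [simp]: "(tm ^^ k) w = [] \<longleftrightarrow> w = []"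
  by (metis length_tm_funpow length_0_conv mult_eq_0_iff power_not_zero zero_neq_numeral)

lemma tm_funpow_add: "(tm ^^ (j + k)) w = (tm ^^ j) ((tm ^^ k) w)"
  by (simp add: funpow_add)

lemma hd_tm_funpow: "w \<noteq> [] \<Longrightarrow> hd ((tm ^^ k) w) = hd w"
proof (induction k)
  case (Suc k)
  have "hd (tm v) = hd v" if "v \<noteq> []" for v
    using that by (cases v; cases "hd v") auto
  with Suc show ?case by simp
qed simp

lemma last_tm_funpow_even:
  assumes "w \<noteq> []" "even k"
  shows "last ((tm ^^ k) w) = last w"
proof -
  have *: "last (tm (tm v)) = last v" if "v \<noteq> []" for v
    using that by (cases v rule: rev_cases; cases "last v") auto
  obtain j where "k = 2 * j"
    using assms(2) by blast
  moreover have "last ((tm ^^ (2 * j)) w) = last w"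
    using assms(1) by (induction j) (auto simp: *)
  ultimately show ?thesis by simp
qed

lemma sublist_tm_funpow: "sublist u v \<Longrightarrow> sublist ((tm ^^ k) u) ((tm ^^ k) v)"
  unfolding sublist_def by (metis tm_funpow_append)

lemma letter_sublist_tm_funpow:
  assumes "k \<ge> 1"
  shows "sublist [c] ((tm ^^ k) [d])"
proof -
  obtain j where k: "k = Suc j"
    using assms by (cases k) auto
  obtain e r where "(tm ^^ j) [d] = e # r"
    by (metis tm_funpow_Nil_iff neq_Nil_conv)
  then have "c \<in> set ((tm ^^ k) [d])"
    unfolding k by (cases c; cases e) auto
  then show ?thesis
    unfolding sublist_def by (metis append_Cons append_Nil split_list)
qed

text \<open>Each letter occurs in all iterates from the first on, so a block seen once is seen in
  every later image of every letter.\<close>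

lemma tm_language_iff: "w \<in> tm_language \<longleftrightarrow> w \<noteq> [] \<and> (\<exists>k c. sublist w ((tm ^^ k) [c]))"
proof (intro iffI conjI)
  assume w: "w \<noteq> [] \<and> (\<exists>k c. sublist w ((tm ^^ k) [c]))"
  then obtain k c where k: "sublist w ((tm ^^ k) [c])" by blast
  have "sublist w ((tm ^^ m) [d])" if "m \<ge> Suc k" for m d
  proof -
    have "sublist ((tm ^^ k) [c]) ((tm ^^ k) ((tm ^^ (m - k)) [d]))"
      using that by (intro sublist_tm_funpow letter_sublist_tm_funpow) simp
    moreover have "(tm ^^ k) ((tm ^^ (m - k)) [d]) = (tm ^^ m) [d]"
      using that tm_funpow_add[of k "m - k"] by simp
    ultimately show ?thesis
      using k sublist_order.order_trans by metis
  qed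
  then show "w \<in> tm_language"
    using w unfolding subst_language_def by auto
qed (auto simp: subst_language_def)

lemma tm_language_deep:
  assumes "w \<in> tm_language"
  obtains v where "sublist w ((tm ^^ k) v)" "v \<in> tm_language"
proof -
  obtain K where K: "\<And>m c. m \<ge> K \<Longrightarrow> sublist w ((tm ^^ m) [c])"
    using assms unfolding subst_language_def by blast
  have "sublist w ((tm ^^ k) ((tm ^^ K) [La]))"
    using K[of "k + K" La] tm_funpow_add by simp
  moreover have "(tm ^^ K) [La] \<in> tm_language"
    unfolding tm_language_iff by auto
  ultimately show thesis using that by blast
qed

lemma tm_language_factor:
  assumes "v \<in> tm_language" "sublist u v" "u \<noteq> []"
  shows "u \<in> tm_language"
  using assms sublist_order.order_trans unfolding tm_language_iff by blast

lemma tm_funpow_language: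
  assumes "w \<in> tm_language"
  shows "(tm ^^ k) w \<in> tm_language"
proof -
  obtain j c where "w \<noteq> []" "sublist w ((tm ^^ j) [c])"
    using assms unfolding tm_language_iff by blast
  then show ?thesis
    using sublist_tm_funpow[of w _ k] tm_funpow_add[of k j] unfolding tm_language_iff
    by (metis tm_funpow_Nil_iff)
qed

lemma sublist_window:
  assumes "x @ w @ y = a @ b @ c" "length x \<le> length a" "length a + length b \<le> length x + length w"
  shows "sublist b w"
proof -
  have "x = take (length x) a"
    using arg_cong[OF assms(1), of "take (length x)"] assms(2) by simp
  then obtain a' where a: "a = x @ a'"
    by (metis append_take_drop_id)
  then have a': "a = x @ a'" "w @ y = a' @ b @ c"
    using assms(1) by simp_all
  have len: "length (a' @ b) \<le> length w"
    using assms(3) a by simp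
  have "take (length (a' @ b)) (w @ y) = take (length (a' @ b)) ((a' @ b) @ c)"
    using a'(2) by simp
  then have "take (length (a' @ b)) w = a' @ b"
    unfolding take_append using len by simp
  then obtain d where "w = (a' @ b) @ d"
    by (metis append_take_drop_id)
  then show ?thesis
    by (auto simp: sublist_def)
qed

lemma sublist_block:
  assumes eq: "x @ w @ y = (tm ^^ k) v" and len: "2 * 2 ^ k \<le> length w"
  shows "\<exists>c. sublist ((tm ^^ k) [c]) w"
proof -
  \<comment> \<open>Index of the first block that starts strictly after position
    \<open>length x\<close>. It starts at most \<open>2 ^ k\<close> later and is therefore complete
    within the next \<open>2 * 2 ^ k\<close> letters.\<close>
  let ?j = "Suc (length x div 2 ^ k)"
  have x: "length x \<le> ?j * 2 ^ k" "?j * 2 ^ k \<le> length x + 2 ^ k"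
  proof -
    have "?j * 2 ^ k = length x div 2 ^ k * 2 ^ k + 2 ^ k" "length x mod 2 ^ k < 2 ^ k"
      by simp_all
    then show "length x \<le> ?j * 2 ^ k" "?j * 2 ^ k \<le> length x + 2 ^ k"
      using div_mult_mod_eq[of "length x" "2 ^ k"] by linarith+
  qed
  have "length x + length w \<le> 2 ^ k * length v"
    using arg_cong[OF eq, of length] by simp
  then have "(?j + 1) * 2 ^ k \<le> length v * 2 ^ k"
    using x(2) len unfolding add_mult_distrib mult_1 by (simp only: mult.commute)
  then have j: "?j < length v"
    using mult_right_le_imp_le[of "?j + 1" "2 ^ k" "length v"] by simp
  then have v: "v = take ?j v @ [v ! ?j] @ drop (Suc ?j) v"
    using id_take_nth_drop by simp
  then have dec: "x @ w @ y = (tm ^^ k) (take ?j v) @ (tm ^^ k) [v ! ?j] @ (tm ^^ k) (drop (Suc ?j) v)"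
    using eq by (metis tm_funpow_append)
  have "length ((tm ^^ k) (take ?j v)) = ?j * 2 ^ k" "length ((tm ^^ k) [v ! ?j]) = 2 ^ k"
    using j by simp_all
  then have "sublist ((tm ^^ k) [v ! ?j]) w"
    by (intro sublist_window[OF dec]) (use x len in linarith)+
  then show ?thesis by blast
qed

interpretation TM: recurrent_language tm_language
proof
  show "[] \<notin> tm_language"
    by (simp add: tm_language_iff)
  show "v \<in> tm_language" if "u @ v @ w \<in> tm_language" "v \<noteq> []" for u v w
    using tm_language_factor[OF that(1) _ that(2)] by (auto simp: sublist_def)
  fix u assume "u \<in> tm_language"
  then obtain K where K: "\<And>c. sublist u ((tm ^^ K) [c])"
    unfolding subst_language_def by blast
  have "sublist u w" if w: "w \<in> tm_language" "2 * 2 ^ K \<le> length w" for w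
  proof -
    obtain v where "sublist w ((tm ^^ K) v)"
      using tm_language_deep[OF w(1)] by blast
    then obtain x y where "x @ w @ y = (tm ^^ K) v"
      unfolding sublist_def by metis
    then obtain c where "sublist ((tm ^^ K) [c]) w"
      using sublist_block w(2) by blast
    then show ?thesis
      using K sublist_order.order_trans by blast
  qed
  then show "\<exists>N. \<forall>w \<in> tm_language. N \<le> length w \<longrightarrow> sublist u w" by blast
qed

section \<open>Parity of squares and recognizability\<close>

lemma tm_nth:
  "i < length w \<Longrightarrow> tm w ! (2 * i) = w ! i \<and> tm w ! Suc (2 * i) \<noteq> w ! i"
proof (induction w arbitrary: i)
  case (Cons c w)
  then show ?case
    by (cases i; cases c) auto
qed simp

text \<open>The two letters of an image block differ, so a square of a letter has to straddle two
  blocks.\<close>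

lemma square_odd_position:
  assumes "x @ [c, c] @ y = tm v"
  shows "odd (length x)"
proof
  assume "even (length x)"
  then obtain i where i: "length x = 2 * i" by blast
  have "i < length v"
    using arg_cong[OF assms, of length] i by simp
  then have "tm v ! length x \<noteq> tm v ! Suc (length x)"
    using tm_nth[of i v] i by metis
  then show False
    by (simp flip: assms add: nth_append)
qed

text \<open>A cube contains squares at two consecutive positions, which cannot both be odd.\<close>

lemma tm_language_cube_free:
  assumes "x @ [c, c, c] @ y \<in> tm_language"
  shows False
proof -
  obtain v where "sublist (x @ [c, c, c] @ y) ((tm ^^ 1) v)"
    using tm_language_deep[OF assms] by blast
  then obtain p q where "p @ (x @ [c, c, c] @ y) @ q = tm v"
    unfolding sublist_def by auto
  then have "(p @ x) @ [c, c] @ (c # y @ q) = tm v" "(p @ x @ [c]) @ [c, c] @ (y @ q) = tm v"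
    by simp_all
  then have "odd (length (p @ x))" "odd (length (p @ x @ [c]))"
    using square_odd_position by blast+
  then show False by simp
qed

lemma tm_prefix_cancel: "tm e @ y = tm v \<Longrightarrow> \<exists>y'. v = e @ y'"
proof (induction e arbitrary: v)
  case (Cons c e)
  then obtain d v' where v: "v = d # v'"
    by (cases v; cases c) auto
  with Cons.prems have "c = d" "tm e @ y = tm v'"
    by (cases c; cases d; simp)+
  with Cons.IH v show ?case by auto
qed simp

lemma tm_factor_cancel:
  assumes "x @ tm e @ y = tm v" "length x = 2 * m"
  shows "\<exists>x' y'. length x' = m \<and> v = x' @ e @ y'"
  using assms
proof (induction m arbitrary: x v)
  case 0
  then show ?case
    using tm_prefix_cancel by (metis append_Nil length_0_conv mult_0_right)
next
  case (Suc m)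
  then obtain b b' x' where x: "x = b # b' # x'" "length x' = 2 * m"
    by (cases x; cases "tl x") auto
  then obtain d v' where v: "v = d # v'"
    using Suc.prems by (cases v) auto
  have "x' @ tm e @ y = tm v'"
    using Suc.prems(1) unfolding x v by (cases d) auto
  then obtain x'' y' where "length x'' = m" "v' = x'' @ e @ y'"
    using Suc.IH x(2) by blast
  then show ?case
    unfolding v by (metis append_Cons length_Cons)
qed

lemma tm_funpow_prefix_ab: "\<exists>r. (tm ^^ k) [La, Lb] = La # Lb # r"
  by (induction k) auto

text \<open>
  Recognizability: the image of \<open>ab\<close> contains a square at an odd position, which fixes the parity
  of each of its occurrences, and the argument can be iterated.
\<close>

lemma tm_synchronization:
  "x @ (tm ^^ k) [La, Lb] @ y = (tm ^^ k) v \<Longrightarrow> 2 ^ k dvd length x"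
proof (induction k arbitrary: x y v)
  case (Suc k)
  let ?e = "(tm ^^ k) [La, Lb]"
  have eq: "x @ tm ?e @ y = tm ((tm ^^ k) v)"
    using Suc.prems by simp
  obtain r where "?e = La # Lb # r"
    using tm_funpow_prefix_ab by blast
  \<comment> \<open>The image of a word starting with \<open>ab\<close> starts with
    \<open>abba\<close>, whose square \<open>bb\<close> sits at offset 1. Its odd position makes
    \<open>length x\<close> even.\<close>
  then have "(x @ [La]) @ [Lb, Lb] @ (La # tm r @ y) = tm ((tm ^^ k) v)"
    using eq by simp
  then have "odd (length (x @ [La]))"
    by (rule square_odd_position)
  then obtain m where m: "length x = 2 * m"
    by auto
  obtain x' y' where "length x' = m" "(tm ^^ k) v = x' @ ?e @ y'"
    using tm_factor_cancel[OF eq m] by blast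
  then have "2 ^ k dvd m"
    using Suc.IH by metis
  then show ?case
    using m by simp
qed simp

lemma tm_funpow_desubstitute:
  assumes eq: "x @ u @ y = (tm ^^ k) v" and dvd: "2 ^ k dvd length x" "2 ^ k dvd length u"
  shows "\<exists>w. u = (tm ^^ k) w \<and> sublist w v"
proof -
  obtain m n where m: "length x = 2 ^ k * m" and n: "length u = 2 ^ k * n"
    using dvd by blast
  have len: "2 ^ k * (m + n) \<le> 2 ^ k * length v"
    using arg_cong[OF eq, of length] m n by (simp add: algebra_simps)
  then have mn: "m + n \<le> length v"
    by simp
  let ?w = "take n (drop m v)"
  have v: "v = take m v @ ?w @ drop n (drop m v)"
    by (metis append_take_drop_id)
  then have "x @ u @ y = (tm ^^ k) (take m v) @ (tm ^^ k) ?w @ (tm ^^ k) (drop n (drop m v))"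
    using eq by (metis tm_funpow_append)
  moreover have "length ((tm ^^ k) (take m v)) = length x" "length ((tm ^^ k) ?w) = length u"
    using m n mn by simp_all
  ultimately have "u = (tm ^^ k) ?w"
    by (metis append_eq_append_conv)
  moreover have "sublist ?w v"
    using v unfolding sublist_def by blast
  ultimately show ?thesis by blast
qed

section \<open>The limits of iterated substitution\<close>

text \<open>The pair of classes of the images of the two letters takes finitely many values and
  determines all other images, so the iterates are eventually periodic. Once \<open>n!\<close> is a
  multiple of the period, the classes are constant and iterating twice changes nothing.\<close>

lemma tm_funpow_stabilizes:
  assumes \<theta>: "fin_cong \<theta>"
  obtains N where "N \<ge> 4" "\<And>n y. n \<ge> N \<Longrightarrow> y \<noteq> [] \<Longrightarrow> ((tm ^^ fact N) y, (tm ^^ fact n) y) \<in> \<theta>"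
    "\<And>n y. n \<ge> N \<Longrightarrow> y \<noteq> [] \<Longrightarrow> ((tm ^^ fact n) y, (tm ^^ fact n) ((tm ^^ fact n) y)) \<in> \<theta>"
proof -
  have "range (\<lambda>m. (\<theta> `` {(tm ^^ m) [La]}, \<theta> `` {(tm ^^ m) [Lb]})) \<subseteq> (words // \<theta>) \<times> (words // \<theta>)"
    by (auto simp: quotientI)
  moreover have "finite ((words // \<theta>) \<times> (words // \<theta>))"
    using fin_cong_finite[OF \<theta>] by simp
  ultimately have "\<not> inj (\<lambda>m. (\<theta> `` {(tm ^^ m) [La]}, \<theta> `` {(tm ^^ m) [Lb]}))"
    using finite_subset range_inj_infinite by blast
  then obtain i j where ij: "i < j" "\<theta> `` {(tm ^^ i) [La]} = \<theta> `` {(tm ^^ j) [La]}"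
    "\<theta> `` {(tm ^^ i) [Lb]} = \<theta> `` {(tm ^^ j) [Lb]}"
    unfolding inj_def by (metis Pair_inject nat_neq_iff)
  define p where "p = j - i"
  have p: "p \<ge> 1" "j = i + p"
    using ij(1) by (auto simp: p_def)
  have letter: "((tm ^^ i) [c], (tm ^^ j) [c]) \<in> \<theta>" for c
    using ij fin_cong_Image_eq[OF \<theta>] by (cases c) auto
  have base: "((tm ^^ i) y, (tm ^^ j) y) \<in> \<theta>" if "y \<noteq> []" for y
    using that
  proof (induction y rule: list_nonempty_induct)
    case (cons c y)
    then show ?case
      using fin_cong_mult[OF \<theta> letter[of c]] by (simp add: tm_funpow_Cons)
  qed (simp add: letter)
  have step: "((tm ^^ m) y, (tm ^^ (m + p)) y) \<in> \<theta>" if "m \<ge> i" "y \<noteq> []" for m y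
  proof -
    have "((tm ^^ i) ((tm ^^ (m - i)) y), (tm ^^ j) ((tm ^^ (m - i)) y)) \<in> \<theta>"
      using that by (intro base) simp
    then show ?thesis
      using that(1) p(2) by (simp flip: tm_funpow_add add: add.commute)
  qed
  have steps: "((tm ^^ m) y, (tm ^^ (m + p * q)) y) \<in> \<theta>" if "m \<ge> i" "y \<noteq> []" for m y q
  proof (induction q)
    case 0
    then show ?case
      using fin_cong_refl[OF \<theta>] that by simp
  next
    case (Suc q)
    have "((tm ^^ (m + p * q)) y, (tm ^^ (m + p * q + p)) y) \<in> \<theta>"
      using that by (intro step) simp_all
    moreover have "m + p * q + p = m + p * Suc q"
      by simp
    ultimately show ?case
      using fin_cong_trans[OF \<theta> Suc.IH] by metis
  qed
  \<comment> \<open>The bound 4 makes the factorials multiples of 4, as required for the end letters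
    and for the invariance of the weights. The bound \<open>i + p\<close> puts them beyond the
    preperiod and makes them divisible by \<open>p\<close>.\<close>
  define N where "N = max 4 (i + p)"
  have dvd: "p dvd fact n" if "n \<ge> N" for n
    using that p(1) by (intro dvd_fact) (auto simp: N_def)
  have ge: "fact n \<ge> i" if "n \<ge> N" for n
    using that fact_ge_self[of n] by (simp add: N_def)
  show thesis
  proof (rule that)
    fix n and y :: "letter list" assume n: "n \<ge> N" and y: "y \<noteq> []"
    have "p dvd fact n - (fact N :: nat)"
      using dvd[OF n] dvd[of N] by (simp add: dvd_diff_nat)
    then obtain q where "fact n = fact N + p * q"
      using fact_mono[OF n, where 'a = nat] by (metis dvdE le_add_diff_inverse)
    then show "((tm ^^ fact N) y, (tm ^^ fact n) y) \<in> \<theta>"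
      using steps[OF ge[of N] y] by simp
    obtain q where "fact n = p * q"
      using dvd[OF n] by blast
    then show "((tm ^^ fact n) y, (tm ^^ fact n) ((tm ^^ fact n) y)) \<in> \<theta>"
      using steps[OF ge[OF n] y, of q] by (simp flip: tm_funpow_add)
  qed (simp add: N_def)
qed

text \<open>The value at \<open>y\<close> of the idempotent limit of the iterates. The choice is
  unambiguous, since two candidates share a representative at each congruence.\<close>

definition tm_limit :: "letter list \<Rightarrow> ((letter list \<times> letter list) set \<Rightarrow> letter list set)" where
  "tm_limit y = (SOME x. x \<in> free_prof \<and>
     (\<forall>\<theta>. fin_cong \<theta> \<longrightarrow> eventually (\<lambda>n. (tm ^^ fact n) y \<in> x \<theta>) sequentially))"

lemma tm_limit:
  assumes y: "y \<noteq> []"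
  shows "tm_limit y \<in> free_prof"
    and "fin_cong \<theta> \<Longrightarrow> eventually (\<lambda>n. (tm ^^ fact n) y \<in> tm_limit y \<theta>) sequentially"
proof -
  have "\<exists>x \<in> free_prof. \<forall>\<theta>. fin_cong \<theta> \<longrightarrow> eventually (\<lambda>n. (tm ^^ fact n) y \<in> x \<theta>) sequentially"
  proof (rule free_prof_compactness)
    fix \<theta> :: "(letter list \<times> letter list) set" assume \<theta>: "fin_cong \<theta>"
    obtain N where "\<And>n. n \<ge> N \<Longrightarrow> ((tm ^^ fact N) y, (tm ^^ fact n) y) \<in> \<theta>"
      using tm_funpow_stabilizes[OF \<theta>] y by metis
    then show "\<exists>C \<in> words // \<theta>. eventually (\<lambda>n. (tm ^^ fact n) y \<in> C) sequentially"
      using y by (intro bexI[of _ "\<theta> `` {(tm ^^ fact N) y}"])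
        (auto simp: quotientI eventually_sequentially)
  next
    fix C D :: "letter list set"
    assume "C \<subseteq> D" "eventually (\<lambda>n. (tm ^^ fact n) y \<in> C) sequentially"
    then show "eventually (\<lambda>n. (tm ^^ fact n) y \<in> D) sequentially"
      by (auto elim: eventually_mono)
  qed
  then have "\<exists>x. x \<in> free_prof \<and>
      (\<forall>\<theta>. fin_cong \<theta> \<longrightarrow> eventually (\<lambda>n. (tm ^^ fact n) y \<in> x \<theta>) sequentially)"
    by blast
  from someI_ex[OF this] show "tm_limit y \<in> free_prof"
    "fin_cong \<theta> \<Longrightarrow> eventually (\<lambda>n. (tm ^^ fact n) y \<in> tm_limit y \<theta>) sequentially"
    unfolding tm_limit_def by blast+
qed

text \<open>One exponent serves all words at once, because stabilization is decided on the two
  letters. That the doubled iterate also represents the limit reflects the idempotence of the limit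
  endomorphism.\<close>

lemma tm_limit_rep:
  assumes \<theta>: "fin_cong \<theta>"
  obtains n where "n \<ge> 4" "\<And>y. y \<noteq> [] \<Longrightarrow> (tm ^^ fact n) y \<in> tm_limit y \<theta>"
    "\<And>y. y \<noteq> [] \<Longrightarrow> (tm ^^ fact n) ((tm ^^ fact n) y) \<in> tm_limit y \<theta>"
    "\<And>m y. y \<noteq> [] \<Longrightarrow> m \<ge> n \<Longrightarrow> (tm ^^ fact m) y \<in> tm_limit y \<theta>"
proof -
  obtain N where N: "N \<ge> 4" "\<And>n y. n \<ge> N \<Longrightarrow> y \<noteq> [] \<Longrightarrow> ((tm ^^ fact N) y, (tm ^^ fact n) y) \<in> \<theta>"
    "\<And>n y. n \<ge> N \<Longrightarrow> y \<noteq> [] \<Longrightarrow> ((tm ^^ fact n) y, (tm ^^ fact n) ((tm ^^ fact n) y)) \<in> \<theta>"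
    using tm_funpow_stabilizes[OF \<theta>] by blast
  have mem: "(tm ^^ fact m) y \<in> tm_limit y \<theta>" if y: "y \<noteq> []" and m: "m \<ge> N" for m y
  proof -
    obtain k where "\<And>n. n \<ge> k \<Longrightarrow> (tm ^^ fact n) y \<in> tm_limit y \<theta>"
      using tm_limit(2)[OF y \<theta>] unfolding eventually_sequentially by blast
    then have lim: "(tm ^^ fact (max k N)) y \<in> tm_limit y \<theta>"
      by simp
    have "((tm ^^ fact (max k N)) y, (tm ^^ fact m) y) \<in> \<theta>"
      using N(2)[OF _ y, of "max k N"] N(2)[OF m y] fin_cong_sym[OF \<theta>] fin_cong_trans[OF \<theta>]
      by (meson max.cobounded2)
    then show ?thesis
      using free_prof_rel[OF tm_limit(1)[OF y] \<theta> lim] by blast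
  qed
  show thesis
  proof (rule that)
    show "(tm ^^ fact N) ((tm ^^ fact N) y) \<in> tm_limit y \<theta>" if y: "y \<noteq> []" for y
      using N(3)[OF order_refl y] mem[OF y order_refl] free_prof_rel[OF tm_limit(1)[OF y] \<theta>] by blast
  qed (use N(1) mem in auto)
qed

lemma tm_limit_append:
  assumes "u \<noteq> []" "v \<noteq> []"
  shows "tm_limit (u @ v) = tm_limit u \<odot> tm_limit v"
proof -
  have "tm_limit u \<odot> tm_limit v = tm_limit (u @ v)"
  proof (rule free_prof_mult_eqI)
    fix \<theta> :: "(letter list \<times> letter list) set" assume "fin_cong \<theta>"
    then obtain n where "\<And>y. y \<noteq> [] \<Longrightarrow> (tm ^^ fact n) y \<in> tm_limit y \<theta>"
      using tm_limit_rep by metis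
    from this[of u] this[of v] this[of "u @ v"] assms
    show "\<exists>p \<in> tm_limit u \<theta>. \<exists>q \<in> tm_limit v \<theta>. p @ q \<in> tm_limit (u @ v) \<theta>"
      by auto
  qed (use assms tm_limit(1) in auto)
  then show ?thesis by simp
qed

lemma tm_limit_closure:
  assumes "y \<in> tm_language"
  shows "tm_limit y \<in> lang_closure tm_language"
proof -
  have y: "y \<noteq> []"
    using assms TM.nonempty by metis
  have "\<exists>w \<in> tm_language. w \<in> tm_limit y \<theta>" if "fin_cong \<theta>" for \<theta>
    using tm_limit_rep[OF that] tm_funpow_language[OF assms] y by metis
  then show ?thesis
    unfolding lang_closure_def using tm_limit(1)[OF y] by simp
qed

text \<open>The end blocks will let the idempotent act on the limits of single letters; the inner
  \<open>abab\<close> makes the limit of \<open>ab\<close> a factor-multiple of its own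
  square.\<close>

lemma tm_funpow_even_ends:
  assumes "even k" "k \<ge> 4"
  obtains p q r s where "(tm ^^ k) [La] = La # Lb # p" "(tm ^^ k) [Lb] = q @ [La, Lb]"
    "(tm ^^ k) [La] = r @ [La, Lb, La, Lb] @ s" "r \<noteq> []" "s \<noteq> []"
proof -
  obtain j where j: "k = 4 + j"
    using assms(2) le_iff_add by blast
  have "hd ((tm ^^ j) [La]) = La"
    by (simp add: hd_tm_funpow)
  then obtain z where "(tm ^^ j) [La] = La # z"
    by (metis list.collapse tm_funpow_Nil_iff not_Cons_self2)
  then have a: "(tm ^^ k) [La] = tm (tm (tm (tm (La # z))))"
    unfolding j by (simp add: tm_funpow_add numeral_eq_Suc)
  have "last ((tm ^^ j) [Lb]) = Lb"
    using assms(1) j by (simp add: last_tm_funpow_even)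
  then obtain z' where "(tm ^^ j) [Lb] = z' @ [Lb]"
    by (metis append_butlast_last_id tm_funpow_Nil_iff not_Cons_self2)
  then have b: "(tm ^^ k) [Lb] = tm (tm (tm (tm (z' @ [Lb]))))"
    unfolding j by (simp add: tm_funpow_add numeral_eq_Suc)
  \<comment> \<open>The fourth image of \<open>a\<close> is \<open>abbabaabbaababba\<close>, with
    \<open>abab\<close> at positions 10 to 13; it is a prefix of all the images considered
    here.\<close>
  show thesis
    by (rule that[of "tl (tl ((tm ^^ k) [La]))" "butlast (butlast ((tm ^^ k) [Lb]))"
          "take 10 ((tm ^^ k) [La])" "drop 14 ((tm ^^ k) [La])"])
      (simp_all add: a b butlast_append numeral_eq_Suc)
qed

text \<open>Says that the limit of \<open>ab\<close> is a group element in each finite quotient. Its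
  representative \<open>c\<close> contains \<open>c c\<close> up to congruence, so stability gives
  \<open>c\<close> as a right multiple of \<open>c c\<close>, and periodicity of the powers of
  \<open>c\<close> does the rest.\<close>

lemma tm_limit_ab_power:
  assumes \<theta>: "fin_cong \<theta>"
  shows "\<exists>c \<in> tm_limit [La, Lb] \<theta>. \<exists>p \<ge> 1. (word_power (Suc p) c, c) \<in> \<theta>"
proof -
  obtain n where n: "n \<ge> 4" "\<And>y. y \<noteq> [] \<Longrightarrow> (tm ^^ fact n) y \<in> tm_limit y \<theta>"
    "\<And>y. y \<noteq> [] \<Longrightarrow> (tm ^^ fact n) ((tm ^^ fact n) y) \<in> tm_limit y \<theta>"
    using tm_limit_rep[OF \<theta>] by metis
  let ?k = "fact n :: nat"
  have k: "?k \<ge> 4" "even ?k"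
    using n(1) fact_ge_self[of n] dvd_fact[of 2 n] by simp_all
  define c where "c = (tm ^^ ?k) [La, Lb]"
  have c: "c = (tm ^^ ?k) [La] @ (tm ^^ ?k) [Lb]" "c \<noteq> []"
    unfolding c_def using tm_funpow_append[of ?k "[La]" "[Lb]"] by simp_all
  obtain r s where rs: "(tm ^^ ?k) [La] = r @ ([La, Lb] @ [La, Lb]) @ s" "r \<noteq> []" "s \<noteq> []"
    using tm_funpow_even_ends[OF k(2,1)] by (metis append_Cons append_Nil)
  have "((tm ^^ ?k) [La], (tm ^^ ?k) ((tm ^^ ?k) [La])) \<in> \<theta>"
    using n(2,3)[of "[La]"] free_prof_rel[OF tm_limit(1) \<theta>] by blast
  \<comment> \<open>The factor \<open>abab\<close> in the image of \<open>a\<close> becomes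
    \<open>c c\<close> in the doubled image, which is congruent to the prefix of \<open>c\<close>
    coming from \<open>a\<close>.\<close>
  moreover have "(tm ^^ ?k) ((tm ^^ ?k) [La]) = (tm ^^ ?k) r @ c @ c @ (tm ^^ ?k) s"
    unfolding rs(1) c_def by (simp del: append_Cons)
  ultimately have "(c, ((tm ^^ ?k) r @ c @ c @ (tm ^^ ?k) s) @ (tm ^^ ?k) [Lb]) \<in> \<theta>"
    using fin_cong_append[OF \<theta>] c(1) by metis
  then obtain t where "(c, (tm ^^ ?k) r @ c @ (c @ t)) \<in> \<theta>"
    by simp
  moreover have "(tm ^^ ?k) r \<noteq> []"
    using rs(2) by simp
  ultimately obtain q where q: "q \<ge> 1" "(c, c @ word_power q (c @ t)) \<in> \<theta>"
    using fin_cong_stability[OF \<theta>] by blast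
  define z where "z = t @ word_power (q - 1) (c @ t)"
  have z: "(c, c @ c @ z) \<in> \<theta>"
    using q by (cases q) (auto simp: z_def)
  have pow: "(c, word_power (Suc i) c @ word_power i z) \<in> \<theta>" for i
  proof (induction i)
    case 0
    then show ?case using fin_cong_refl[OF \<theta> c(2)] by simp
  next
    case (Suc i)
    have "(word_power i c @ c @ word_power i z, word_power i c @ (c @ c @ z) @ word_power i z) \<in> \<theta>"
      by (intro fin_cong_prepend fin_cong_append \<theta> z)
    moreover have "word_power i c @ c @ word_power i z = word_power (Suc i) c @ word_power i z"
      by (subst word_power_Suc_right) simp
    moreover have "word_power i c @ (c @ c @ z) @ word_power i z =
      word_power (Suc (Suc i)) c @ word_power (Suc i) z"
    proof -
      have "word_power (Suc (Suc i)) c = word_power i c @ c @ c"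
        by (simp only: word_power_Suc_right append_assoc)
      then show ?thesis
        by (simp only:) simp
    qed
    ultimately show ?case
      using fin_cong_trans[OF \<theta> Suc.IH] by metis
  qed
  obtain i p where ip: "i \<ge> 1" "p \<ge> 1" "(word_power i c, word_power (i + p) c) \<in> \<theta>"
    using word_power_eventually_periodic[OF \<theta> c(2)] by metis
  have i: "Suc (i - 1) = i"
    using ip(1) by simp
  have c1: "(c, word_power i c @ word_power (i - 1) z) \<in> \<theta>"
    using pow[of "i - 1"] unfolding i .
  \<comment> \<open>With \<open>c\<close> written as \<open>c^i z^(i-1)\<close>, a further factor
    \<open>c^p\<close> on the left is swallowed by the periodic power.\<close>
  have "(word_power p c @ c, word_power p c @ word_power i c @ word_power (i - 1) z) \<in> \<theta>"
    by (intro fin_cong_prepend \<theta> c1)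
  moreover have "word_power p c @ word_power i c @ word_power (i - 1) z =
      word_power (i + p) c @ word_power (i - 1) z"
    by (simp add: word_power_add[of p i, symmetric] add.commute)
  moreover have "(word_power (i + p) c @ word_power (i - 1) z, word_power i c @ word_power (i - 1) z) \<in> \<theta>"
    by (intro fin_cong_append \<theta> fin_cong_sym[OF \<theta> ip(3)])
  ultimately have "(word_power p c @ c, c) \<in> \<theta>"
    using fin_cong_trans[OF \<theta>] fin_cong_sym[OF \<theta> c1] by metis
  then have "(word_power (Suc p) c, c) \<in> \<theta>"
    by (simp only: word_power_Suc_right)
  moreover have "c \<in> tm_limit [La, Lb] \<theta>"
    unfolding c_def by (intro n(2)) simp
  ultimately show ?thesis
    using ip(2) by blast
qed

section \<open>Generators of a maximal subgroup\<close>

text \<open>These properties describe the idempotent power of the limit of \<open>ab\<close>. The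
  last one keeps its approximation by powers of representatives, which later provides words with
  prescribed ends.\<close>

locale tm_idempotent =
  fixes f :: "(letter list \<times> letter list) set \<Rightarrow> letter list set"
  assumes f_closure: "f \<in> lang_closure tm_language"
    and f_idem: "f \<odot> f = f"
    and f_left: "f \<odot> tm_limit [La, Lb] = tm_limit [La, Lb]"
    and f_right: "tm_limit [La, Lb] \<odot> f = tm_limit [La, Lb]"
    and f_power: "fin_cong \<theta> \<Longrightarrow> \<exists>c \<in> tm_limit [La, Lb] \<theta>. \<exists>p \<ge> 1. word_power p c \<in> f \<theta>"

lemma aabb_in_tm_language: "[La, La, Lb, Lb] \<in> tm_language"
proof -
  have "(tm ^^ 4) [La] = [La, Lb, Lb, La, Lb] @ [La, La, Lb, Lb] @ [La, La, Lb, La, Lb, Lb, La]"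
    by (simp add: numeral_eq_Suc)
  then show ?thesis
    unfolding tm_language_iff by (metis sublist_appendI list.distinct(1))
qed

lemma blocks_in_tm_language:
  "[La, Lb] \<in> tm_language" "[La, La, Lb] \<in> tm_language" "[La, Lb, Lb] \<in> tm_language"
  using TM.factor[of "[La]" "[La, Lb]" "[Lb]"] TM.factor[of "[]" "[La, La, Lb]" "[Lb]"]
    TM.factor[of "[La]" "[La, Lb, Lb]" "[]"] aabb_in_tm_language by simp_all

text \<open>If \<open>c^(p+1)\<close> is congruent to \<open>c\<close>, then \<open>c^p\<close> is
  an identity for \<open>c\<close> and is idempotent. Compactness collects these powers into one
  element, which lies in the closure as a left factor of the limit of \<open>ab\<close>.\<close>

lemma tm_idempotent_exists: "\<exists>f. tm_idempotent f"
proof -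
  let ?x = "tm_limit [La, Lb]"
  have x: "?x \<in> free_prof" "?x \<in> lang_closure tm_language"
    using tm_limit(1) tm_limit_closure blocks_in_tm_language by simp_all
  have "\<exists>f \<in> free_prof. \<forall>\<theta>. fin_cong \<theta> \<longrightarrow>
    (\<exists>c \<in> ?x \<theta>. \<exists>p \<ge> 1. word_power p c \<in> f \<theta> \<and> (word_power (Suc p) c, c) \<in> \<theta>)"
  proof (rule free_prof_compactness)
    fix \<theta> :: "(letter list \<times> letter list) set" assume \<theta>: "fin_cong \<theta>"
    obtain c p where c: "c \<in> ?x \<theta>" "p \<ge> 1" "(word_power (Suc p) c, c) \<in> \<theta>"
      using tm_limit_ab_power[OF \<theta>] by blast
    have "word_power p c \<noteq> []"
      using c(2) free_prof_nonempty[OF x(1) \<theta> c(1)] by simp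
    then have "\<theta> `` {word_power p c} \<in> words // \<theta>" "word_power p c \<in> \<theta> `` {word_power p c}"
      using fin_cong_refl[OF \<theta>] by (simp_all only: quotientI words_iff Image_singleton_iff not_False_eq_True)
    then show "\<exists>C \<in> words // \<theta>. \<exists>c \<in> ?x \<theta>. \<exists>p \<ge> 1. word_power p c \<in> C \<and> (word_power (Suc p) c, c) \<in> \<theta>"
      using c by blast
  next
    fix \<theta> \<eta> :: "(letter list \<times> letter list) set" and C D
    assume "fin_cong \<theta>" "fin_cong \<eta>" "\<theta> \<subseteq> \<eta>" "C \<subseteq> D"
      "\<exists>c \<in> ?x \<theta>. \<exists>p \<ge> 1. word_power p c \<in> C \<and> (word_power (Suc p) c, c) \<in> \<theta>"
    then show "\<exists>c \<in> ?x \<eta>. \<exists>p \<ge> 1. word_power p c \<in> D \<and> (word_power (Suc p) c, c) \<in> \<eta>"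
      using free_prof_mono[OF x(1)] by (meson subsetD)
  qed
  then obtain f where f: "f \<in> free_prof" and stage: "\<And>\<theta>. fin_cong \<theta> \<Longrightarrow>
    \<exists>c \<in> ?x \<theta>. \<exists>p \<ge> 1. word_power p c \<in> f \<theta> \<and> (word_power (Suc p) c, c) \<in> \<theta>"
    by blast
  have right: "?x \<odot> f = ?x"
  proof (rule free_prof_mult_eqI)
    fix \<theta> :: "(letter list \<times> letter list) set" assume \<theta>: "fin_cong \<theta>"
    then obtain c p where c: "c \<in> ?x \<theta>" "word_power p c \<in> f \<theta>" "(word_power (Suc p) c, c) \<in> \<theta>"
      using stage by blast
    then have "c @ word_power p c \<in> ?x \<theta>"
      using free_prof_rel[OF x(1) \<theta> c(1)] fin_cong_sym[OF \<theta>] by simp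
    then show "\<exists>u \<in> ?x \<theta>. \<exists>v \<in> f \<theta>. u @ v \<in> ?x \<theta>"
      using c by blast
  qed (use f x in auto)
  have left: "f \<odot> ?x = ?x"
  proof (rule free_prof_mult_eqI)
    fix \<theta> :: "(letter list \<times> letter list) set" assume \<theta>: "fin_cong \<theta>"
    then obtain c p where c: "c \<in> ?x \<theta>" "word_power p c \<in> f \<theta>" "(word_power (Suc p) c, c) \<in> \<theta>"
      using stage by blast
    then have "word_power p c @ c \<in> ?x \<theta>"
      using free_prof_rel[OF x(1) \<theta> c(1)] fin_cong_sym[OF \<theta>] by (metis word_power_Suc_right)
    then show "\<exists>u \<in> f \<theta>. \<exists>v \<in> ?x \<theta>. u @ v \<in> ?x \<theta>"
      using c by blast
  qed (use f x in auto)
  have idem: "f \<odot> f = f"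
  proof (rule free_prof_mult_eqI)
    fix \<theta> :: "(letter list \<times> letter list) set" assume \<theta>: "fin_cong \<theta>"
    then obtain c p where c: "c \<in> ?x \<theta>" "word_power p c \<in> f \<theta>" "(word_power (Suc p) c, c) \<in> \<theta>" "p \<ge> 1"
      using stage by blast
    then obtain q where q: "p = Suc q"
      by (cases p) auto
    have "(word_power (Suc p) c @ word_power q c, c @ word_power q c) \<in> \<theta>"
      by (intro fin_cong_append \<theta> c(3))
    moreover have "word_power (Suc p) c @ word_power q c = word_power p c @ word_power p c"
      unfolding q word_power_add[symmetric] by simp
    moreover have "c @ word_power q c = word_power p c"
      unfolding q by simp
    ultimately have "(word_power p c, word_power p c @ word_power p c) \<in> \<theta>"
      using fin_cong_sym[OF \<theta>] by metis
    then have "word_power p c @ word_power p c \<in> f \<theta>"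
      using free_prof_rel[OF f \<theta> c(2)] by blast
    then show "\<exists>u \<in> f \<theta>. \<exists>v \<in> f \<theta>. u @ v \<in> f \<theta>"
      using c(2) by blast
  qed (use f in auto)
  have "f \<in> lang_closure tm_language"
    using TM.lang_closure_factor(1)[OF f x(1)] left x(2) by simp
  with left right idem stage have "tm_idempotent f"
    by unfold_locales blast+
  then show ?thesis by blast
qed

context tm_idempotent
begin

abbreviation "tm_group \<equiv> local_group tm_language f"

abbreviation "tm_generators \<equiv> {tm_limit [La, Lb], tm_limit [La, La, Lb], tm_limit [La, Lb, Lb]}"

section \<open>The idempotent acting on limits of letters and of return words\<close>

lemma f_free_prof: "f \<in> free_prof"
  using f_closure lang_closure_free_prof by blast

text \<open>The even iterates of \<open>a\<close> start with \<open>ab\<close>, so the limit of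
  \<open>a\<close> starts with the limit of \<open>ab\<close>, on which \<open>f\<close> acts
  trivially. Together with the mirrored \<open>f_right_b\<close> this puts the limits of blocks from
  \<open>a\<close> to \<open>b\<close> into the group.\<close>

lemma f_left_a: "f \<odot> tm_limit [La] = tm_limit [La]"
proof (rule free_prof_mult_eqI)
  fix \<theta> :: "(letter list \<times> letter list) set" assume \<theta>: "fin_cong \<theta>"
  obtain n where n: "n \<ge> 4" "\<And>y. y \<noteq> [] \<Longrightarrow> (tm ^^ fact n) y \<in> tm_limit y \<theta>"
    "\<And>y. y \<noteq> [] \<Longrightarrow> (tm ^^ fact n) ((tm ^^ fact n) y) \<in> tm_limit y \<theta>"
    using tm_limit_rep[OF \<theta>] by metis
  let ?k = "fact n :: nat"
  have k: "?k \<ge> 4" "even ?k"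
    using n(1) fact_ge_self[of n] dvd_fact[of 2 n] by simp_all
  obtain r where r: "(tm ^^ ?k) [La] = [La, Lb] @ r"
    using tm_funpow_even_ends[OF k(2,1)] by (metis append_Cons append_Nil)
  obtain w where w: "w \<in> f \<theta>"
    using free_prof_rep[OF f_free_prof \<theta>] by blast
  let ?c = "(tm ^^ ?k) [La, Lb]"
  have c: "?c \<in> tm_limit [La, Lb] \<theta>"
    by (intro n(2)) simp
  have ab: "tm_limit [La, Lb] \<in> free_prof"
    by (intro tm_limit(1)) simp
  have "(?c, w @ ?c) \<in> \<theta>"
    using free_prof_mult_rep[OF f_free_prof ab \<theta> w c] f_left free_prof_rel[OF ab \<theta> c] by simp
  then have "(?c @ (tm ^^ ?k) r, (w @ ?c) @ (tm ^^ ?k) r) \<in> \<theta>"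
    by (intro fin_cong_append \<theta>)
  moreover have "?c @ (tm ^^ ?k) r = (tm ^^ ?k) ((tm ^^ ?k) [La])"
    unfolding r by (simp del: append_Cons)
  moreover have a: "(tm ^^ ?k) ((tm ^^ ?k) [La]) \<in> tm_limit [La] \<theta>"
    by (intro n(3)) simp
  ultimately have "w @ (tm ^^ ?k) ((tm ^^ ?k) [La]) \<in> tm_limit [La] \<theta>"
    using free_prof_rel[OF tm_limit(1) \<theta> a] by simp
  then show "\<exists>u \<in> f \<theta>. \<exists>v \<in> tm_limit [La] \<theta>. u @ v \<in> tm_limit [La] \<theta>"
    using w a by blast
qed (use tm_limit(1) f_free_prof in auto)

lemma f_right_b: "tm_limit [Lb] \<odot> f = tm_limit [Lb]"
proof (rule free_prof_mult_eqI)
  fix \<theta> :: "(letter list \<times> letter list) set" assume \<theta>: "fin_cong \<theta>"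
  obtain n where n: "n \<ge> 4" "\<And>y. y \<noteq> [] \<Longrightarrow> (tm ^^ fact n) y \<in> tm_limit y \<theta>"
    "\<And>y. y \<noteq> [] \<Longrightarrow> (tm ^^ fact n) ((tm ^^ fact n) y) \<in> tm_limit y \<theta>"
    using tm_limit_rep[OF \<theta>] by metis
  let ?k = "fact n :: nat"
  have k: "?k \<ge> 4" "even ?k"
    using n(1) fact_ge_self[of n] dvd_fact[of 2 n] by simp_all
  obtain r where r: "(tm ^^ ?k) [Lb] = r @ [La, Lb]"
    using tm_funpow_even_ends[OF k(2,1)] by metis
  obtain w where w: "w \<in> f \<theta>"
    using free_prof_rep[OF f_free_prof \<theta>] by blast
  let ?c = "(tm ^^ ?k) [La, Lb]"
  have c: "?c \<in> tm_limit [La, Lb] \<theta>"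
    by (intro n(2)) simp
  have ab: "tm_limit [La, Lb] \<in> free_prof"
    by (intro tm_limit(1)) simp
  have "(?c, ?c @ w) \<in> \<theta>"
    using free_prof_mult_rep[OF ab f_free_prof \<theta> c w] f_right free_prof_rel[OF ab \<theta> c] by simp
  then have "((tm ^^ ?k) r @ ?c, (tm ^^ ?k) r @ ?c @ w) \<in> \<theta>"
    by (intro fin_cong_prepend \<theta>)
  moreover have "(tm ^^ ?k) r @ ?c = (tm ^^ ?k) ((tm ^^ ?k) [Lb])"
    unfolding r by simp
  moreover have b: "(tm ^^ ?k) ((tm ^^ ?k) [Lb]) \<in> tm_limit [Lb] \<theta>"
    by (intro n(3)) simp
  ultimately have "(tm ^^ ?k) ((tm ^^ ?k) [Lb]) @ w \<in> tm_limit [Lb] \<theta>"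
    using free_prof_rel[OF tm_limit(1) \<theta> b] by (metis append_assoc not_Cons_self2)
  then show "\<exists>u \<in> tm_limit [Lb] \<theta>. \<exists>v \<in> f \<theta>. u @ v \<in> tm_limit [Lb] \<theta>"
    using w b by blast
qed (use tm_limit(1) f_free_prof in auto)

lemma tm_limit_in_group:
  assumes y: "y \<in> tm_language" "hd y = La" "last y = Lb"
  shows "tm_limit y \<in> carrier tm_group"
proof -
  have "y \<noteq> []"
    using y TM.nonempty by metis
  then obtain v where v: "y = [La] @ v" "v \<noteq> []"
    using y by (cases y) (auto split: if_splits)
  have "y = butlast y @ [Lb]" "butlast y \<noteq> []"
    using \<open>y \<noteq> []\<close> y(3) v by (metis append_butlast_last_id, simp)
  then obtain u where u: "y = u @ [Lb]" "u \<noteq> []"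
    by blast
  have "f \<odot> tm_limit y = tm_limit y"
    unfolding v(1) using v(2) tm_limit(1) f_free_prof f_left_a
    by (simp only: tm_limit_append free_prof_mult_assoc[symmetric] not_Cons_self2 not_False_eq_True)
  moreover have "tm_limit y \<odot> f = tm_limit y"
    unfolding u(1) using u(2) tm_limit(1) f_free_prof f_right_b
    by (simp only: tm_limit_append free_prof_mult_assoc not_Cons_self2 not_False_eq_True)
  ultimately show ?thesis
    using tm_limit_closure[OF y(1)] by (simp add: local_group_def)
qed

lemma group_tm_group: "group tm_group"
  by (rule TM.group_local_group[OF f_closure f_idem])

lemma tm_group_simps: "mult tm_group = (\<odot>)" "one tm_group = f"
  by (simp_all add: local_group_def)

lemma tm_generators_subset: "tm_generators \<subseteq> carrier tm_group"
  using tm_limit_in_group blocks_in_tm_language by simp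

text \<open>
  The fourth return word \<open>aabb\<close> to \<open>b.a\<close> is redundant, because its limit is the product of the
  limits of \<open>aab\<close>, the inverse of \<open>ab\<close>, and \<open>abb\<close>.
\<close>

lemma tm_limit_aabb_generated: "tm_limit [La, La, Lb, Lb] \<in> generate tm_group tm_generators"
proof -
  interpret group tm_group by (rule group_tm_group)
  let ?a = "tm_limit [La]" and ?b = "tm_limit [Lb]" and ?x = "tm_limit [La, Lb]"
  let ?g = "tm_limit [La, La, Lb] \<otimes>\<^bsub>tm_group\<^esub> inv\<^bsub>tm_group\<^esub> ?x \<otimes>\<^bsub>tm_group\<^esub> tm_limit [La, Lb, Lb]"
  have x: "?x \<in> carrier tm_group"
    using tm_generators_subset by blast
  have ix: "inv\<^bsub>tm_group\<^esub> ?x \<in> carrier tm_group" "?x \<odot> inv\<^bsub>tm_group\<^esub> ?x = f"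
    using x r_inv[OF x] by (simp_all add: tm_group_simps)
  have free: "?a \<in> free_prof" "?b \<in> free_prof" "?x \<in> free_prof" "inv\<^bsub>tm_group\<^esub> ?x \<in> free_prof"
    using tm_limit(1) ix(1) lang_closure_free_prof by (auto simp: local_group_def)
  have "tm_limit [La, La, Lb] = ?a \<odot> ?x" "tm_limit [La, Lb, Lb] = ?x \<odot> ?b"
    using tm_limit_append[of "[La]" "[La, Lb]"] tm_limit_append[of "[La, Lb]" "[Lb]"] by simp_all
  then have "?g = ?a \<odot> (?x \<odot> inv\<^bsub>tm_group\<^esub> ?x) \<odot> ?x \<odot> ?b"
    using free by (simp add: tm_group_simps free_prof_mult_assoc)
  also have "\<dots> = ?a \<odot> (?x \<odot> ?b)"
    using free f_free_prof f_left unfolding ix(2)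
    by (metis free_prof_mult_assoc free_prof_mult_closed)
  also have "\<dots> = tm_limit [La, La, Lb, Lb]"
    using tm_limit_append[of "[La]" "[La, Lb, Lb]"] tm_limit_append[of "[La, Lb]" "[Lb]"] by simp
  finally have "tm_limit [La, La, Lb, Lb] = ?g" by simp
  moreover have "?g \<in> generate tm_group tm_generators"
    by (intro generate.eng) (auto intro: generate.incl generate.inv)
  ultimately show ?thesis by simp
qed

text \<open>Without cubes, a word from \<open>a\<close> to \<open>b\<close> is a product of pieces
  consisting of one or two \<open>a\<close> followed by one or two \<open>b\<close>, and these are
  exactly the four return words.\<close>

lemma tm_limit_generated:
  assumes "y \<in> tm_language" "hd y = La" "last y = Lb"
  shows "tm_limit y \<in> generate tm_group tm_generators"
  using assms
proof (induction y rule: length_induct)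
  case (1 y)
  have split: "tm_limit y \<in> generate tm_group tm_generators"
    if y: "y = u @ v" and u: "u \<noteq> []" "tm_limit u \<in> generate tm_group tm_generators"
      and v: "v = [] \<or> hd v = La" for u v
  proof (cases "v = []")
    case False
    then have "v \<in> tm_language"
      using TM.factor[of u v "[]"] 1 y by simp
    then have "tm_limit v \<in> generate tm_group tm_generators"
      using 1 y u(1) v False by simp
    then have "tm_limit u \<otimes>\<^bsub>tm_group\<^esub> tm_limit v \<in> generate tm_group tm_generators"
      using u(2) generate.eng by fast
    then show ?thesis
      using y tm_limit_append[OF u(1) False] by (simp add: tm_group_simps)
  qed (use y u in simp)
  have gen: "tm_limit [La, Lb] \<in> generate tm_group tm_generators"
    "tm_limit [La, La, Lb] \<in> generate tm_group tm_generators"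
    "tm_limit [La, Lb, Lb] \<in> generate tm_group tm_generators"
    by (auto intro: generate.incl)
  have cube: False if "y = [c, c, c] @ q" for c q
    using tm_language_cube_free[of "[]" c q] 1 that by simp
  have cube': False if "y = [d, c, c, c] @ q" for c d q
    using tm_language_cube_free[of "[d]" c q] 1 that by simp
  have cube'': False if "y = [d, d', c, c, c] @ q" for c d d' q
    using tm_language_cube_free[of "[d, d']" c q] 1 that by simp
  have ne: "y \<noteq> []"
    using 1 TM.nonempty by metis
  \<comment> \<open>The piece split off first is maximal, so that the rest is empty or starts again
    with \<open>a\<close>; the last letter is inherited.\<close>
  consider v where "y = [La, Lb] @ v" "v = [] \<or> hd v = La"
    | v where "y = [La, Lb, Lb] @ v" "v = [] \<or> hd v = La"
    | v where "y = [La, La, Lb] @ v" "v = [] \<or> hd v = La"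
    | v where "y = [La, La, Lb, Lb] @ v" "v = [] \<or> hd v = La"
  proof -
    have letters: "c = La \<or> c = Lb" for c by (cases c) auto
    obtain v1 where v1: "y = La # v1" "v1 \<noteq> []"
      using ne 1 by (cases y) (auto split: if_splits)
    obtain d v2 where v2: "v1 = d # v2"
      using v1 by (cases v1) auto
    show thesis
    proof (cases d)
      case Lb
      show thesis
      proof (cases "v2 = [] \<or> hd v2 = La")
        case True
        then show thesis using that(1) v1 v2 Lb by simp
      next
        case False
        then obtain v3 where v3: "v2 = Lb # v3"
          using letters by (cases v2) auto
        have "v3 = [] \<or> hd v3 = La"
          using cube'[of La Lb "tl v3"] letters v1 v2 v3 Lb by (cases v3) auto
        then show thesis using that(2) v1 v2 v3 Lb by simp
      qed
    next
      case La
      then have "v2 \<noteq> []"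
        using 1 v1 v2 by auto
      then obtain v3 where v3: "v2 = Lb # v3"
        using cube[of La "tl v2"] letters La v1 v2 by (cases v2) auto
      show thesis
      proof (cases "v3 = [] \<or> hd v3 = La")
        case True
        then show thesis using that(3) v1 v2 v3 La by simp
      next
        case False
        then obtain v4 where v4: "v3 = Lb # v4"
          using letters by (cases v3) auto
        have "v4 = [] \<or> hd v4 = La"
          using cube''[of La La Lb "tl v4"] letters v1 v2 v3 v4 La by (cases v4) auto
        then show thesis using that(4) v1 v2 v3 v4 La by simp
      qed
    qed
  qed
  then show ?case
    by cases (use split gen tm_limit_aabb_generated in blast)+
qed

text \<open>Since \<open>f\<close> fixes \<open>g\<close> and is approximated by powers of
  representatives of the limit of \<open>ab\<close>, some representative of \<open>g\<close> starts
  with a prescribed image of \<open>ab\<close>, and some representative ends with it.\<close>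

lemma tm_group_prefix:
  assumes g: "g \<in> carrier tm_group" and \<theta>: "fin_cong \<theta>"
    and n: "\<And>m y. y \<noteq> [] \<Longrightarrow> m \<ge> n \<Longrightarrow> (tm ^^ fact m) y \<in> tm_limit y \<theta>"
    and m: "m \<ge> n"
  shows "\<exists>z. (tm ^^ fact m) [La, Lb] @ z \<in> g \<theta>" "\<exists>z. z @ (tm ^^ fact m) [La, Lb] \<in> g \<theta>"
proof -
  let ?c = "(tm ^^ fact m) [La, Lb]"
  have gf: "g \<in> free_prof" "f \<odot> g = g" "g \<odot> f = g"
    using g lang_closure_free_prof by (auto simp: local_group_def)
  have c: "?c \<in> tm_limit [La, Lb] \<theta>"
    using m by (intro n) simp_all
  obtain d p where d: "d \<in> tm_limit [La, Lb] \<theta>" "p \<ge> 1" "word_power p d \<in> f \<theta>"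
    using f_power[OF \<theta>] by blast
  then obtain q where q: "p = Suc q"
    by (cases p) auto
  have dc: "(d, ?c) \<in> \<theta>"
    using free_prof_rel[OF tm_limit(1) \<theta> d(1)] c by simp
  obtain w where w: "w \<in> g \<theta>"
    using free_prof_rep[OF gf(1) \<theta>] by blast
  \<comment> \<open>The power provided by \<open>f_power\<close> has an unknown base
    \<open>d\<close>; replacing only its first or its last factor by the iterate \<open>?c\<close>
    is enough.\<close>
  have "(d @ word_power q d, ?c @ word_power q d) \<in> \<theta>" "(word_power q d @ d, word_power q d @ ?c) \<in> \<theta>"
    by (intro fin_cong_append fin_cong_prepend \<theta> dc)+
  moreover have "d @ word_power q d = word_power p d" "word_power q d @ d = word_power p d"
    unfolding q by (simp, simp only: word_power_Suc_right)
  ultimately have "?c @ word_power q d \<in> f \<theta>" "word_power q d @ ?c \<in> f \<theta>"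
    using free_prof_rel[OF f_free_prof \<theta> d(3)] by metis+
  then have "(?c @ word_power q d) @ w \<in> g \<theta>" "w @ (word_power q d @ ?c) \<in> g \<theta>"
    using free_prof_mult_rep[OF f_free_prof gf(1) \<theta>] free_prof_mult_rep[OF gf(1) f_free_prof \<theta>] w gf
    by metis+
  then show "\<exists>z. ?c @ z \<in> g \<theta>" "\<exists>z. z @ ?c \<in> g \<theta>"
    by (metis append_assoc)+
qed

text \<open>A representative of \<open>g\<close> that starts and ends with the same long image of
  \<open>ab\<close> is aligned with the blocks at both ends by synchronization. So it is the image
  of a word from \<open>a\<close> to \<open>b\<close>, whose limit is generated and agrees with
  \<open>g\<close> at \<open>\<theta>\<close>.\<close>

lemma tm_generators_dense:
  assumes g: "g \<in> carrier tm_group" and \<theta>: "fin_cong \<theta>"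
  shows "\<exists>h \<in> generate tm_group tm_generators. h \<theta> = g \<theta>"
proof -
  obtain n where n: "n \<ge> 4" "\<And>y. y \<noteq> [] \<Longrightarrow> (tm ^^ fact n) y \<in> tm_limit y \<theta>"
    using tm_limit_rep[OF \<theta>] by metis
  define k where "k = (fact n :: nat)"
  have even_k: "even k"
    using n(1) dvd_fact[of 2 n] by (simp add: k_def)
  \<comment> \<open>The length of the image of \<open>ab\<close>. Refining by
    \<open>ends_cong N\<close> makes the ends of every representative equal, and not merely
    congruent, to this image.\<close>
  define N :: nat where "N = 2 * 2 ^ k"
  have gf: "g \<in> free_prof" "g \<in> lang_closure tm_language"
    using g lang_closure_free_prof by (auto simp: local_group_def)
  have \<eta>: "fin_cong (\<theta> \<inter> ends_cong N)"
    by (intro fin_cong_Int \<theta> fin_cong_ends_cong)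
  obtain u where u: "u \<in> tm_language" "u \<in> g (\<theta> \<inter> ends_cong N)"
    using lang_closure_rep[OF gf(2) \<eta>] by blast
  obtain n' where n': "\<And>m y. y \<noteq> [] \<Longrightarrow> m \<ge> n' \<Longrightarrow> (tm ^^ fact m) y \<in> tm_limit y (\<theta> \<inter> ends_cong N)"
    using tm_limit_rep[OF \<eta>] by metis
  define m where "m = max n n'"
  let ?e = "(tm ^^ k) [La, Lb]"
  have "k \<le> fact m"
    unfolding k_def by (intro fact_mono) (simp add: m_def)
  moreover have "even (fact m :: nat)"
    using n(1) dvd_fact[of 2 m] by (simp add: m_def)
  ultimately obtain j where j: "fact m = k + j" "even j"
    using even_k by (metis even_add le_iff_add)
  have e_len: "length ?e = N"
    by (simp add: N_def)
  obtain r where r: "(tm ^^ j) [La, Lb] = [La, Lb] @ r"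
    using tm_funpow_prefix_ab by (metis append_Cons append_Nil)
  \<comment> \<open>The evenness of \<open>j\<close> matters: the first image of \<open>ab\<close>
    is \<open>abba\<close>, which does not end with \<open>ab\<close>.\<close>
  have "\<exists>r'. (tm ^^ j) [La, Lb] = r' @ [La, Lb]"
  proof (cases "j = 0")
    case False
    then have j2: "j \<ge> 2"
      using j(2) by (cases j; cases "j - 1") auto
    then obtain i where i: "j = Suc (Suc i)" "even i"
      using j(2) by (metis add_2_eq_Suc le_Suc_ex even_Suc)
    have "last ((tm ^^ i) [La, Lb]) = Lb"
      using i(2) by (simp add: last_tm_funpow_even)
    then have "(tm ^^ i) [La, Lb] = butlast ((tm ^^ i) [La, Lb]) @ [Lb]"
      using append_butlast_last_id[of "(tm ^^ i) [La, Lb]"] by simp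
    then obtain z where "(tm ^^ i) [La, Lb] = z @ [Lb]"
      by blast
    then show ?thesis
      unfolding i(1) by simp
  qed simp
  then obtain r' where r': "(tm ^^ j) [La, Lb] = r' @ [La, Lb]" by blast
  have pre: "(tm ^^ fact m) [La, Lb] = ?e @ (tm ^^ k) r"
    unfolding j(1) tm_funpow_add r by (simp del: append_Cons)
  have suf: "(tm ^^ fact m) [La, Lb] = (tm ^^ k) r' @ ?e"
    unfolding j(1) tm_funpow_add r' by simp
  obtain z where z: "(tm ^^ fact m) [La, Lb] @ z \<in> g (\<theta> \<inter> ends_cong N)"
    using tm_group_prefix(1)[OF g \<eta> n'] by (metis m_def max.cobounded2)
  obtain z' where z': "z' @ (tm ^^ fact m) [La, Lb] \<in> g (\<theta> \<inter> ends_cong N)"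
    using tm_group_prefix(2)[OF g \<eta> n'] by (metis m_def max.cobounded2)
  have take_e: "take N (?e @ s) = ?e" "take N (rev ?e @ s) = rev ?e" for s
    by (simp_all add: N_def)
  have "(u, ?e @ (tm ^^ k) r @ z) \<in> ends_cong N"
    using free_prof_rel[OF gf(1) \<eta> u(2)] z unfolding pre append_assoc by blast
  then have "take N u = ?e"
    using take_e(1)[of "(tm ^^ k) r @ z"] unfolding ends_cong_def by (simp del: take_append)
  moreover have "(u, (z' @ (tm ^^ k) r') @ ?e) \<in> ends_cong N"
    using free_prof_rel[OF gf(1) \<eta> u(2)] z' unfolding suf append_assoc by blast
  then have "take N (rev u) = rev ?e"
    using take_e(2)[of "rev (z' @ (tm ^^ k) r')"] unfolding ends_cong_def rev_append
    by (simp del: take_append)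
  ultimately have "take N u = ?e" "take N (rev u) = rev ?e"
    by blast+
  then obtain u1 u2 where u12: "u = ?e @ u1" "rev u = rev ?e @ u2"
    by (metis append_take_drop_id)
  then have u2: "u = rev u2 @ ?e"
    by (metis rev_append rev_rev_ident)
  obtain v where v: "v \<in> tm_language" "sublist u ((tm ^^ k) v)"
    using tm_language_deep[OF u(1)] by metis
  then obtain x y where xy: "x @ u @ y = (tm ^^ k) v"
    unfolding sublist_def by metis
  have "x @ ?e @ (u1 @ y) = (tm ^^ k) v"
    using xy u12 by simp
  then have dx: "2 ^ k dvd length x"
    by (rule tm_synchronization)
  have "(x @ rev u2) @ ?e @ y = (tm ^^ k) v"
    using xy u2 by simp
  then have "2 ^ k dvd length (x @ rev u2)"
    by (rule tm_synchronization)
  then have "2 ^ k dvd length (rev u2)"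
    using dx by (simp add: dvd_add_right_iff)
  then have "2 ^ k dvd length u"
    using arg_cong[OF u2, of length] by simp
  then obtain w where w: "u = (tm ^^ k) w" "sublist w v"
    using tm_funpow_desubstitute[OF xy dx] by blast
  have "u \<noteq> []"
    using u(1) TM.nonempty by metis
  then have w_ne: "w \<noteq> []"
    using w(1) by simp
  then have "w \<in> tm_language"
    using tm_language_factor v(1) w(2) by blast
  moreover have "hd w = La"
    using hd_tm_funpow[OF w_ne, of k] hd_tm_funpow[of "[La, Lb]" k] u12(1) w(1)
    by (metis hd_append2 list.sel(1) not_Cons_self2 tm_funpow_Nil_iff neq_Nil_conv)
  moreover have "last w = Lb"
    using last_tm_funpow_even[OF w_ne even_k] last_tm_funpow_even[of "[La, Lb]" k] even_k u2 w(1)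
    by simp
  ultimately have gen: "tm_limit w \<in> generate tm_group tm_generators"
    by (rule tm_limit_generated)
  \<comment> \<open>The exponent \<open>k\<close> was chosen for \<open>\<theta>\<close> before the
    refinement, so the block length does not depend on the finer congruence.\<close>
  have "u \<in> tm_limit w \<theta>"
    unfolding w(1) k_def using w_ne by (rule n(2))
  moreover have "u \<in> g \<theta>"
    using free_prof_mono[OF gf(1) \<eta> \<theta>] u(2) by blast
  ultimately have "tm_limit w \<theta> = g \<theta>"
    using free_prof_eq_Image[OF gf(1) \<theta>, of u] free_prof_eq_Image[OF tm_limit(1)[OF w_ne] \<theta>, of u]
    by simp
  with gen show ?thesis by blast
qed

end

section \<open>The generalized dihedral group of order 18\<close>

type_synonym dih18_elem = "3 \<times> 3 \<times> bool"

definition signed :: "bool \<Rightarrow> 3 \<Rightarrow> 3" where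
  "signed p x = (if p then - x else x)"

text \<open>The semidirect product of \<open>(Z/3)^2\<close> with a group of order two acting by
  negation. The boolean component marks reflections.\<close>

fun dih18_mult :: "dih18_elem \<Rightarrow> dih18_elem \<Rightarrow> dih18_elem" (infixl "\<star>" 70) where
  "(x, y, p) \<star> (x', y', q) = (x + signed p x', y + signed p y', p \<noteq> q)"

definition dih18 :: "dih18_elem monoid" where
  "dih18 = \<lparr>carrier = UNIV, mult = dih18_mult, one = (0, 0, False)\<rparr>"

lemma dih18_simps [simp]: "carrier dih18 = UNIV" "mult dih18 = dih18_mult" "one dih18 = (0, 0, False)"
  by (simp_all add: dih18_def)

lemma dih18_assoc: "a \<star> b \<star> c = a \<star> (b \<star> c)"
  by (cases a; cases b; cases c) (auto simp: signed_def)

lemma dih18_one [simp]: "(0, 0, False) \<star> a = a" "a \<star> (0, 0, False) = a"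
  by (cases a; simp add: signed_def)+

lemma group_dih18: "group dih18"
proof (rule groupI)
  fix a :: dih18_elem
  assume "a \<in> carrier dih18"
  obtain x y p where a: "a = (x, y, p)"
    by (cases a)
  have "(- signed p x, - signed p y, p) \<star> a = (0, 0, False)"
    by (simp add: a signed_def)
  then show "\<exists>b \<in> carrier dih18. b \<otimes>\<^bsub>dih18\<^esub> a = \<one>\<^bsub>dih18\<^esub>"
    by auto
qed (auto simp: dih18_assoc)

lemma order_dih18: "order dih18 = 18"
  by (simp add: order_def card_cartesian_product flip: UNIV_Times_UNIV)

abbreviation dih18_generators :: "dih18_elem set" where
  "dih18_generators \<equiv> {(0, 0, True), (1, 0, False), (0, 1, False)}"

lemma three_cases: "x = 0 \<or> x = 1 \<or> x = (2 :: 3)"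
proof -
  have "(UNIV :: 3 set) = {0, 1, 2}"
    by (intro card_subset_eq[symmetric]) auto
  then show ?thesis by blast
qed

lemma generate_dih18: "generate dih18 dih18_generators = UNIV"
proof -
  let ?S = "generate dih18 dih18_generators"
  have mult: "a \<star> b \<in> ?S" if "a \<in> ?S" "b \<in> ?S" for a b
    using generate.eng[OF that] by simp
  have gen: "(0, 0, True) \<in> ?S" "(1, 0, False) \<in> ?S" "(0, 1, False) \<in> ?S" "(0, 0, False) \<in> ?S"
    using generate.one[of dih18 dih18_generators] by (auto intro: generate.incl)
  have "(x, 0, False) \<in> ?S" for x
    using three_cases[of x] gen mult[OF gen(2) gen(2)] by (auto simp: signed_def)
  moreover have "(0, y, False) \<in> ?S" for y
    using three_cases[of y] gen mult[OF gen(3) gen(3)] by (auto simp: signed_def)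
  moreover have "(0, 0, p) \<in> ?S" for p
    using gen by (cases p) auto
  ultimately have "(x, 0, False) \<star> (0, y, False) \<star> (0, 0, p) \<in> ?S" for x y p
    by (intro mult)
  then show ?thesis
    by (auto simp: signed_def)
qed

text \<open>
  Each linear relation of the following kind cuts out a subgroup, and any two elements satisfy a
  common nontrivial relation, so that they cannot generate the group.
\<close>

lemma dih18_relation_generate:
  assumes "\<And>x y p. (x, y, p) \<in> X \<Longrightarrow> \<alpha> * x + \<beta> * y + \<kappa> * of_bool p = 0"
    and "(x, y, p) \<in> generate dih18 X"
  shows "\<alpha> * x + \<beta> * y + \<kappa> * of_bool p = 0"
proof -
  interpret group dih18 by (rule group_dih18)
  define K where "K = {(x, y, p). \<alpha> * x + \<beta> * y + \<kappa> * of_bool p = 0}"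
  have mult: "a \<star> b \<in> K" if "a \<in> K" "b \<in> K" for a b
  proof -
    obtain x y p x' y' q where ab: "a = (x, y, p)" "b = (x', y', q)"
      by (cases a; cases b)
    then have "\<alpha> * x + \<beta> * y + \<kappa> * of_bool p = 0" "\<alpha> * x' + \<beta> * y' + \<kappa> * of_bool q = 0"
      using that by (simp_all add: K_def)
    then have "\<alpha> * x + \<beta> * y = - (\<kappa> * of_bool p)" "\<alpha> * x' + \<beta> * y' = - (\<kappa> * of_bool q)"
      by (simp_all add: eq_neg_iff_add_eq_0)
    \<comment> \<open>A leading reflection negates the linear form of the second factor. The
      constants of two reflections thus cancel, matching the trivial flag of their product.\<close>
    moreover have "\<alpha> * (x + signed p x') + \<beta> * (y + signed p y') =
      (\<alpha> * x + \<beta> * y) + signed p (\<alpha> * x' + \<beta> * y')"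
      by (simp add: signed_def algebra_simps)
    ultimately have "\<alpha> * (x + signed p x') + \<beta> * (y + signed p y') =
      - (\<kappa> * of_bool p) + signed p (- (\<kappa> * of_bool q))"
      by (simp only:)
    then show ?thesis
      unfolding ab K_def by (cases p; cases q) (simp_all add: signed_def)
  qed
  have "subgroup K dih18"
  proof (rule subgroupI)
    show "K \<noteq> {}"
      unfolding K_def by (auto intro!: exI[of _ 0] exI[of _ False])
    fix a assume a: "a \<in> K"
    obtain x y p where a': "a = (x, y, p)"
      by (cases a)
    have "inv\<^bsub>dih18\<^esub> a = (- signed p x, - signed p y, p)"
      by (rule inv_equality) (simp_all add: a' signed_def)
    then show "inv\<^bsub>dih18\<^esub> a \<in> K"
      using a unfolding a' K_def by (cases p) (auto simp: signed_def algebra_simps neg_eq_iff_add_eq_0)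
  qed (use mult in auto)
  moreover have "X \<subseteq> K"
  proof
    fix a assume "a \<in> X"
    moreover obtain x y p where "a = (x, y, p)"
      by (cases a)
    ultimately show "a \<in> K"
      using assms(1)[of x y p] by (simp add: K_def)
  qed
  ultimately show ?thesis
    using generate_subgroup_incl[of X K] assms(2) unfolding K_def by auto
qed

text \<open>Two homogeneous linear equations in three unknowns over the field with three elements.
  If neither element is a reflection, \<open>\<kappa>\<close> is free; otherwise a reflection
  determines \<open>\<kappa>\<close>, and one equation for \<open>\<alpha>\<close> and
  \<open>\<beta>\<close> remains.\<close>

lemma dih18_pair_relation:
  fixes a b :: dih18_elem
  shows "\<exists>\<alpha> \<beta> \<kappa>. (\<alpha>, \<beta>, \<kappa>) \<noteq> (0, 0, 0 :: 3) \<and>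
    (\<forall>(x, y, p) \<in> {a, b}. \<alpha> * x + \<beta> * y + \<kappa> * of_bool p = 0)"
proof -
  obtain x y p x' y' q where ab: "a = (x, y, p)" "b = (x', y', q)"
    by (cases a; cases b)
  have orth: "\<exists>\<alpha> \<beta>. (\<alpha>, \<beta>) \<noteq> (0, 0) \<and> \<alpha> * d + \<beta> * d' = 0" for d d' :: 3
  proof (cases "d = 0 \<and> d' = 0")
    case False
    then show ?thesis
      by (intro exI[of _ d'] exI[of _ "- d"]) auto
  qed (auto intro: exI[of _ 1])
  consider "\<not> p" "\<not> q" | "p" | "\<not> p" "q" by blast
  then show ?thesis
  proof cases
    case 1
    then show ?thesis
      unfolding ab by (intro exI[of _ 0] exI[of _ 1]) simp
  next
    case 2
    obtain \<alpha> \<beta> where *: "(\<alpha>, \<beta>) \<noteq> (0, 0)" "\<alpha> * (x' - of_bool q * x) + \<beta> * (y' - of_bool q * y) = 0"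
      using orth by blast
    then have "\<alpha> * x' + \<beta> * y' + - (\<alpha> * x + \<beta> * y) * of_bool q = 0"
      by (simp add: algebra_simps)
    then show ?thesis
      using 2 *(1) unfolding ab by (intro exI[of _ \<alpha>] exI[of _ \<beta>] exI[of _ "- (\<alpha> * x + \<beta> * y)"]) auto
  next
    case 3
    obtain \<alpha> \<beta> where *: "(\<alpha>, \<beta>) \<noteq> (0, 0)" "\<alpha> * x + \<beta> * y = 0"
      using orth by blast
    then show ?thesis
      using 3 unfolding ab by (intro exI[of _ \<alpha>] exI[of _ \<beta>] exI[of _ "- (\<alpha> * x' + \<beta> * y')"]) auto
  qed
qed

lemma dih18_generators_card:
  assumes "finite X" "generate dih18 X = UNIV"
  shows "card X \<ge> 3"
proof (rule ccontr)
  assume "\<not> card X \<ge> 3"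
  then have "card X = 0 \<or> card X = 1 \<or> card X = 2"
    by linarith
  then have "\<exists>a b. X \<subseteq> {a, b}"
  proof (elim disjE)
    assume "card X = 2"
    then show ?thesis
      unfolding card_2_iff by blast
  next
    assume "card X = 1"
    then obtain a where "X = {a}"
      by (rule card_1_singletonE)
    then show ?thesis by blast
  qed (use assms(1) in auto)
  then obtain a b where X: "X \<subseteq> {a, b}" by blast
  obtain \<alpha> \<beta> \<kappa> where ne: "(\<alpha>, \<beta>, \<kappa>) \<noteq> (0, 0, 0 :: 3)"
    and rel: "\<forall>(x, y, p) \<in> {a, b}. \<alpha> * x + \<beta> * y + \<kappa> * of_bool p = 0"
    using dih18_pair_relation[of a b] by (elim exE conjE)
  have "\<alpha> * x + \<beta> * y + \<kappa> * of_bool p = 0" for x y p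
  proof (rule dih18_relation_generate)
    show "\<alpha> * x + \<beta> * y + \<kappa> * of_bool p = 0" if "(x, y, p) \<in> X" for x y p
      using rel X that by blast
    show "(x, y, p) \<in> generate dih18 X"
      using assms(2) by simp
  qed
  \<comment> \<open>The two unit translations and the central reflection read off the three
    coefficients.\<close>
  from this[of 1 0 False] this[of 0 1 False] this[of 0 0 True] ne show False
    by simp
qed

section \<open>The homomorphism onto the group of order 18\<close>

text \<open>
  The weights are chosen so that the return words \<open>ab\<close>, \<open>aab\<close>, \<open>abb\<close> receive the three standard
  generators and the fourth power of the substitution preserves all values.
\<close>

fun weight :: "letter \<Rightarrow> letter \<Rightarrow> dih18_elem" where
  "weight La La = (1, 0, True)"
| "weight La Lb = (0, 0, True)"
| "weight Lb La = (0, 0, False)"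
| "weight Lb Lb = (0, -1, True)"

fun cocycle :: "letter list \<Rightarrow> dih18_elem" where
  "cocycle (c # d # w) = weight c d \<star> cocycle (d # w)"
| "cocycle w = (0, 0, False)"

lemma cocycle_append:
  "u \<noteq> [] \<Longrightarrow> v \<noteq> [] \<Longrightarrow> cocycle (u @ v) = cocycle u \<star> weight (last u) (hd v) \<star> cocycle v"
proof (induction u rule: cocycle.induct)
  case (1 c d w)
  then show ?case by (simp add: dih18_assoc)
next
  case ("2_2" c)
  then show ?case by (cases v) simp_all
qed simp

lemma last_tm_funpow_4: "w \<noteq> [] \<Longrightarrow> last ((tm ^^ 4) w) = last w"
  by (simp add: last_tm_funpow_even)

text \<open>The fourth image of a letter has trivial product of weights and the same first and last
  letter as its argument, so only the junction weights survive. The second power also keeps the end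
  letters, but the product over \<open>abba\<close> is the translation
  \<open>(0, 1, False)\<close>.\<close>

lemma cocycle_tm_funpow_4:
  assumes "w \<noteq> []"
  shows "cocycle ((tm ^^ 4) w) = cocycle w"
  using assms
proof (induction w rule: list_nonempty_induct)
  case (single c)
  show ?case
    by (cases c) (simp_all add: eval_nat_numeral signed_def)
next
  case (cons c w)
  have "(tm ^^ 4) [c] \<noteq> []" "(tm ^^ 4) w \<noteq> []"
    using cons.hyps by simp_all
  moreover have "cocycle ((tm ^^ 4) [c]) = (0, 0, False)"
    by (cases c) (simp_all add: eval_nat_numeral signed_def)
  ultimately have "cocycle ((tm ^^ 4) (c # w)) = weight c (hd w) \<star> cocycle w"
    using cons last_tm_funpow_4[of "[c]"] hd_tm_funpow[of w 4]
    by (simp add: tm_funpow_Cons cocycle_append)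
  then show ?case
    using cons.hyps by (cases w) simp_all
qed

lemma cocycle_tm_funpow:
  assumes "w \<noteq> []" "4 dvd k"
  shows "cocycle ((tm ^^ k) w) = cocycle w"
proof -
  obtain j where "k = 4 * j"
    using assms(2) by blast
  moreover have "cocycle ((tm ^^ (4 * j)) w) = cocycle w"
  proof (induction j)
    case (Suc j)
    have "(tm ^^ (4 * Suc j)) w = (tm ^^ 4) ((tm ^^ (4 * j)) w)"
      by (simp flip: tm_funpow_add)
    then show ?case
      using Suc cocycle_tm_funpow_4[of "(tm ^^ (4 * j)) w"] assms(1) by simp
  qed simp
  ultimately show ?thesis by simp
qed

text \<open>The end letters belong to the invariant because the junction weight of a product depends
  on them.\<close>

definition weight_cong :: "(letter list \<times> letter list) set" where
  "weight_cong = {(u, v). u \<noteq> [] \<and> v \<noteq> [] \<and> (hd u, last u, cocycle u) = (hd v, last v, cocycle v)}"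

lemma weight_congD:
  assumes "(u, v) \<in> weight_cong"
  shows "hd u = hd v" "last u = last v" "cocycle u = cocycle v"
  using assms by (simp_all add: weight_cong_def)

lemma fin_cong_weight_cong: "fin_cong weight_cong"
  unfolding weight_cong_def
proof (rule fin_cong_kernel)
  show "finite ((\<lambda>u. (hd u, last u, cocycle u)) ` words)"
    by (rule finite_subset[of _ "UNIV :: (letter \<times> letter \<times> dih18_elem) set"]) simp_all
qed (auto simp: cocycle_append)

text \<open>The weight from the last letter back to the first closes the word cyclically. It
  anticipates the junction weight that arises when two group elements are multiplied.\<close>

definition weight_value :: "((letter list \<times> letter list) set \<Rightarrow> letter list set) \<Rightarrow> dih18_elem" where
  "weight_value x = (let w = SOME w. w \<in> x weight_cong in cocycle w \<star> weight (last w) (hd w))"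

lemma weight_value_eq:
  assumes "x \<in> free_prof" "w \<in> x weight_cong"
  shows "weight_value x = cocycle w \<star> weight (last w) (hd w)"
proof -
  have "(SOME w. w \<in> x weight_cong) \<in> x weight_cong"
    using assms(2) by (rule someI)
  then have "(w, SOME w. w \<in> x weight_cong) \<in> weight_cong"
    using free_prof_rel[OF assms(1) fin_cong_weight_cong assms(2)] by blast
  from weight_congD[OF this] show ?thesis
    by (simp add: weight_value_def Let_def)
qed

lemma weight_value_tm_limit:
  assumes y: "y \<noteq> []"
  shows "weight_value (tm_limit y) = cocycle y \<star> weight (last y) (hd y)"
proof -
  obtain n where n: "n \<ge> 4" "(tm ^^ fact n) y \<in> tm_limit y weight_cong"
    using tm_limit_rep[OF fin_cong_weight_cong] y by metis
  have "4 dvd (fact n :: nat)" "even (fact n :: nat)"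
    using n(1) dvd_fact[of 4 n] dvd_fact[of 2 n] by simp_all
  then show ?thesis
    using weight_value_eq[OF tm_limit(1)[OF y] n(2)] cocycle_tm_funpow[OF y] hd_tm_funpow[OF y]
      last_tm_funpow_even[OF y] by simp
qed

text \<open>All elements of the group inherit the first and last letter of the representatives of
  \<open>e\<close>. Hence the junction weight in a product is the closing weight of the first
  factor, and the closing weight of the product is that of the second.\<close>

lemma weight_value_hom:
  assumes e: "e \<in> lang_closure tm_language"
  shows "weight_value \<in> hom (local_group tm_language e) dih18"
proof (rule homI)
  fix x y
  assume "x \<in> carrier (local_group tm_language e)" "y \<in> carrier (local_group tm_language e)"
  then have x: "x \<in> free_prof" "e \<odot> x = x" "x \<odot> e = x" and y: "y \<in> free_prof" "e \<odot> y = y" "y \<odot> e = y"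
    using lang_closure_free_prof by (auto simp: local_group_def)
  note ef = lang_closure_free_prof[OF e] and \<theta> = fin_cong_weight_cong
  obtain w where w: "w \<in> e weight_cong" "w \<noteq> []"
    using free_prof_rep[OF ef \<theta>] by blast
  obtain u v where u: "u \<in> x weight_cong" "u \<noteq> []" and v: "v \<in> y weight_cong" "v \<noteq> []"
    using free_prof_rep[OF x(1) \<theta>] free_prof_rep[OF y(1) \<theta>] by metis
  have wu: "(u, w @ u) \<in> weight_cong" "(u, u @ w) \<in> weight_cong"
    using free_prof_mult_rep[OF ef x(1) \<theta> w(1) u(1)] free_prof_mult_rep[OF x(1) ef \<theta> u(1) w(1)]
      free_prof_rel[OF x(1) \<theta> u(1)] x by simp_all
  have u': "hd u = hd w" "last u = last w"
    using w(2) weight_congD(1)[OF wu(1)] weight_congD(2)[OF wu(2)] by simp_all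
  have wv: "(v, w @ v) \<in> weight_cong" "(v, v @ w) \<in> weight_cong"
    using free_prof_mult_rep[OF ef y(1) \<theta> w(1) v(1)] free_prof_mult_rep[OF y(1) ef \<theta> v(1) w(1)]
      free_prof_rel[OF y(1) \<theta> v(1)] y by simp_all
  have v': "hd v = hd w" "last v = last w"
    using w(2) weight_congD(1)[OF wv(1)] weight_congD(2)[OF wv(2)] by simp_all
  have "weight_value (x \<odot> y) = cocycle (u @ v) \<star> weight (last (u @ v)) (hd (u @ v))"
    using x y u v by (intro weight_value_eq free_prof_mult_rep \<theta>) auto
  also have "\<dots> = weight_value x \<star> weight_value y"
    using u v u' v' by (simp add: cocycle_append weight_value_eq[OF x(1) u(1)]
        weight_value_eq[OF y(1) v(1)] dih18_assoc)
  finally show "weight_value (x \<otimes>\<^bsub>local_group tm_language e\<^esub> y) =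
    weight_value x \<otimes>\<^bsub>dih18\<^esub> weight_value y"
    by (simp add: local_group_def)
qed simp

lemma weight_value_cong:
  assumes "x \<in> free_prof" "y \<in> free_prof" "x weight_cong = y weight_cong"
  shows "weight_value x = weight_value y"
  using assms by (simp add: weight_value_def)

lemma (in tm_idempotent) weight_value_generators:
  "weight_value ` tm_generators = dih18_generators"
proof -
  have "weight_value (tm_limit [La, Lb]) = (0, 0, True)"
    "weight_value (tm_limit [La, La, Lb]) = (1, 0, False)"
    "weight_value (tm_limit [La, Lb, Lb]) = (0, 1, False)"
    by (simp_all add: weight_value_tm_limit signed_def)
  then show ?thesis by simp
qed

lemma (in tm_idempotent) weight_value_surj: "weight_value ` carrier tm_group = UNIV"
proof -
  interpret group_hom tm_group dih18 weight_value
    by (intro group_hom.intro group_hom_axioms.intro group_tm_group group_dih18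
        weight_value_hom f_closure)
  have "UNIV = weight_value ` generate tm_group tm_generators"
    using generate_img[OF tm_generators_subset] generate_dih18 weight_value_generators by simp
  also have "\<dots> \<subseteq> weight_value ` carrier tm_group"
    using G.generate_incl[OF tm_generators_subset] by blast
  finally show ?thesis by blast
qed

section \<open>Transfer to an arbitrary maximal subgroup\<close>

text \<open>Relabels a finite group by natural numbers, the carrier type in which the quotient of
  order 18 is demanded.\<close>

lemma isomorphic_nat_monoid:
  assumes "group A" "finite (carrier A)"
  obtains H :: "nat monoid" and h where "group H" "h \<in> hom A H" "bij_betw h (carrier A) (carrier H)"
proof -
  interpret A: group A by fact
  obtain h :: "_ \<Rightarrow> nat" where h: "bij_betw h (carrier A) {0..<card (carrier A)}"
    using ex_bij_betw_finite_nat[OF assms(2)] by blast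
  define k where "k = inv_into (carrier A) h"
  define H where "H = \<lparr>carrier = {0..<card (carrier A)},
    mult = (\<lambda>x y. h (k x \<otimes>\<^bsub>A\<^esub> k y)), one = h \<one>\<^bsub>A\<^esub>\<rparr>"
  have kh: "k (h a) = a" if "a \<in> carrier A" for a
    using that h unfolding k_def by (simp add: bij_betw_def inv_into_f_f)
  have hA: "h a \<in> carrier H" if "a \<in> carrier A" for a
    using that h unfolding H_def by (auto simp: bij_betw_def)
  have hom: "h \<in> hom A H"
    by (rule homI) (use hA kh in \<open>auto simp: H_def\<close>)
  have surj: "\<exists>a \<in> carrier A. x = h a" if "x \<in> carrier H" for x
    using that h unfolding H_def by (auto simp: bij_betw_def)
  have mult: "h a \<otimes>\<^bsub>H\<^esub> h b = h (a \<otimes>\<^bsub>A\<^esub> b)" if "a \<in> carrier A" "b \<in> carrier A" for a b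
    using that kh by (simp add: H_def)
  have one: "\<one>\<^bsub>H\<^esub> = h \<one>\<^bsub>A\<^esub>"
    by (simp add: H_def)
  have "group H"
  proof (rule groupI)
    fix x y z assume "x \<in> carrier H" "y \<in> carrier H" "z \<in> carrier H"
    then obtain a b c where "a \<in> carrier A" "b \<in> carrier A" "c \<in> carrier A" "x = h a" "y = h b" "z = h c"
      using surj by metis
    then show "x \<otimes>\<^bsub>H\<^esub> y \<otimes>\<^bsub>H\<^esub> z = x \<otimes>\<^bsub>H\<^esub> (y \<otimes>\<^bsub>H\<^esub> z)"
      by (simp add: mult A.m_assoc)
  next
    fix x y assume "x \<in> carrier H" "y \<in> carrier H"
    then show "x \<otimes>\<^bsub>H\<^esub> y \<in> carrier H"
      using surj mult hA by (metis A.m_closed)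
  next
    fix x assume "x \<in> carrier H"
    then obtain a where a: "a \<in> carrier A" "x = h a"
      using surj by blast
    then show "\<one>\<^bsub>H\<^esub> \<otimes>\<^bsub>H\<^esub> x = x"
      by (simp add: one mult)
    show "\<exists>y \<in> carrier H. y \<otimes>\<^bsub>H\<^esub> x = \<one>\<^bsub>H\<^esub>"
      using a hA mult one A.l_inv A.inv_closed by metis
  qed (simp add: one hA)
  moreover have "bij_betw h (carrier A) (carrier H)"
    using h by (simp add: H_def)
  ultimately show thesis
    using hom that by blast
qed

lemma top_generates_discrete:
  "top_generates G (discrete_topology (carrier G)) X \<longleftrightarrow>
    X \<subseteq> carrier G \<and> carrier G \<inter> generate G X = carrier G"
  by (simp add: top_generates_def discrete_topology_closure_of)

lemma has_rank_discrete_iso: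
  assumes A: "group A" and H: "group H" and h: "h \<in> hom A H" "bij_betw h (carrier A) (carrier H)"
    and X: "finite X" "card X = n" "X \<subseteq> carrier A" "generate A X = carrier A"
    and min: "\<And>Y. finite Y \<Longrightarrow> Y \<subseteq> carrier A \<Longrightarrow> generate A Y = carrier A \<Longrightarrow> n \<le> card Y"
  shows "has_rank H (discrete_topology (carrier H)) n"
proof -
  interpret group_hom A H h
    by (intro group_hom.intro group_hom_axioms.intro A H h)
  have inj: "inj_on h (carrier A)" and surj: "h ` carrier A = carrier H"
    using h(2) by (auto simp: bij_betw_def)
  have "top_generates H (discrete_topology (carrier H)) (h ` X)"
    using X(3) surj generate_img[OF X(3)] X(4) unfolding top_generates_discrete by auto
  moreover have "card (h ` X) = n"
    using X inj by (metis card_image inj_on_subset)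
  moreover have "n \<le> card Z" if Z: "top_generates H (discrete_topology (carrier H)) Z" "finite Z" for Z
  proof -
    define Y where "Y = {a \<in> carrier A. h a \<in> Z}"
    have ZH: "Z \<subseteq> carrier H" "carrier H \<inter> generate H Z = carrier H"
      using Z(1) unfolding top_generates_discrete by simp_all
    then have genZ: "generate H Z = carrier H"
      using H.generate_incl[OF ZH(1)] by blast
    have hY: "h ` Y = Z"
      using ZH(1) unfolding surj[symmetric] Y_def by auto
    have YA: "Y \<subseteq> carrier A"
      by (auto simp: Y_def)
    have "finite Y"
      using Z(2) hY inj YA by (metis finite_imageD inj_on_subset)
    moreover have "generate A Y = carrier A"
    proof
      show "generate A Y \<subseteq> carrier A"
        by (rule G.generate_incl[OF YA])
      show "carrier A \<subseteq> generate A Y"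
      proof
        fix a assume a: "a \<in> carrier A"
        then have "h a \<in> h ` generate A Y"
          using generate_img[OF YA] hY genZ surj by blast
        then show "a \<in> generate A Y"
          using inj a G.generate_incl[OF YA] by (auto dest: inj_onD)
      qed
    qed
    ultimately have "n \<le> card Y"
      using min YA by blast
    also have "card Y = card Z"
      using hY inj YA by (metis card_image inj_on_subset)
    finally show ?thesis .
  qed
  ultimately show ?thesis
    unfolding has_rank_def using X(1) by blast
qed

text \<open>A map that factors through one finite quotient is locally constant.\<close>

lemma continuous_map_schutz_discrete:
  assumes "carrier G \<subseteq> free_prof" "fin_cong \<theta>"
    and "\<And>x y. x \<in> carrier G \<Longrightarrow> y \<in> carrier G \<Longrightarrow> x \<theta> = y \<theta> \<Longrightarrow> F x = F y"
    and "F ` carrier G \<subseteq> Y"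
  shows "continuous_map (schutz_topology G) (discrete_topology Y) F"
proof -
  have top: "topspace (schutz_topology G) = carrier G"
    using assms(1) by (auto simp: schutz_topology_def)
  have "openin (schutz_topology G) {x \<in> carrier G. F x \<in> U}" for U
  proof -
    let ?V = "{y \<in> free_prof. \<exists>x \<in> carrier G. F x \<in> U \<and> y \<theta> = x \<theta>}"
    have "openin free_prof_topology ?V"
      unfolding openin_free_prof_topology using assms(2) by (auto intro!: exI[of _ \<theta>])
    then have "openin (schutz_topology G) (carrier G \<inter> ?V)"
      unfolding schutz_topology_def by (rule openin_subtopology_Int2)
    moreover have "carrier G \<inter> ?V = {x \<in> carrier G. F x \<in> U}"
    proof (intro Set.set_eqI iffI)
      fix y assume "y \<in> carrier G \<inter> ?V"
      then obtain x where "y \<in> carrier G" "x \<in> carrier G" "F x \<in> U" "y \<theta> = x \<theta>"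
        by blast
      then show "y \<in> {x \<in> carrier G. F x \<in> U}"
        using assms(3)[of y x] by simp
    qed (use assms(1) in blast)
    ultimately show ?thesis by simp
  qed
  then show ?thesis
    using assms(4) by (auto simp: continuous_map_def top)
qed

lemma closure_of_schutz_topology:
  assumes "carrier G \<subseteq> free_prof" "A \<subseteq> carrier G"
  shows "Abstract_Topology.closure_of (schutz_topology G) A =
    {x \<in> carrier G. \<forall>\<theta>. fin_cong \<theta> \<longrightarrow> (\<exists>a \<in> A. a \<theta> = x \<theta>)}"
proof -
  have "carrier G \<inter> A = A" "A \<subseteq> free_prof"
    using assms by auto
  then show ?thesis
    unfolding schutz_topology_def closure_of_subtopology
    using closure_of_free_prof_topology[of A] assms(1) by auto
qed

text \<open>Conjugation carries generators and homomorphism over to the group at \<open>e\<close>.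
  As the homomorphism factors through \<open>weight_cong\<close>, a topologically generating set is
  mapped to a set that generates the finite group outright, which gives the lower bound.\<close>

lemma (in tm_idempotent) schutz_group_properties:
  assumes e: "e \<in> lang_closure tm_language" "e \<odot> e = e"
  defines "G \<equiv> local_group tm_language e"
  shows "\<exists>H :: nat monoid. group H \<and> order H = 18 \<and>
      has_rank H (discrete_topology (carrier H)) 3 \<and>
      continuous_hom_image G (schutz_topology G) H (discrete_topology (carrier H))"
    and "has_rank G (schutz_topology G) 3"
proof -
  obtain s t where st: "s \<in> free_prof" "t \<in> free_prof"
    and \<alpha>: "(\<lambda>x. s \<odot> x \<odot> t) \<in> hom tm_group G" and \<beta>: "(\<lambda>x. t \<odot> x \<odot> s) \<in> hom G tm_group"
    and \<beta>\<alpha>: "\<forall>x \<in> carrier tm_group. t \<odot> (s \<odot> x \<odot> t) \<odot> s = x"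
    and \<alpha>\<beta>: "\<forall>x \<in> carrier G. s \<odot> (t \<odot> x \<odot> s) \<odot> t = x"
    using TM.local_groups_iso[OF e f_closure f_idem, folded G_def] by (elim bexE conjE)
  have group_G: "group G"
    unfolding G_def by (rule TM.group_local_group[OF e])
  have G_free: "carrier G \<subseteq> free_prof"
    unfolding G_def using lang_closure_free_prof by (auto simp: local_group_def)
  have tm_free: "carrier tm_group \<subseteq> free_prof"
    using lang_closure_free_prof by (auto simp: local_group_def)
  interpret \<alpha>: group_hom tm_group G "\<lambda>x. s \<odot> x \<odot> t"
    by (intro group_hom.intro group_hom_axioms.intro group_tm_group group_G \<alpha>)
  define F where "F = (\<lambda>x. weight_value (t \<odot> x \<odot> s))"
  have F_hom: "F \<in> hom G dih18"
    using hom_compose[OF \<beta> weight_value_hom[OF f_closure]] by (simp add: F_def comp_def)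
  interpret F: group_hom G dih18 F
    by (intro group_hom.intro group_hom_axioms.intro group_G group_dih18 F_hom)
  have F_surj: "F ` carrier G = UNIV"
  proof -
    have "d \<in> F ` carrier G" for d
    proof -
      obtain x where x: "x \<in> carrier tm_group" "d = weight_value x"
        using weight_value_surj by blast
      then have "F (s \<odot> x \<odot> t) = d"
        using \<beta>\<alpha> by (simp add: F_def)
      then show ?thesis
        using \<alpha>.hom_closed[OF x(1)] by blast
    qed
    then show ?thesis by blast
  qed
  \<comment> \<open>The class of a conjugate at \<open>\<theta>\<close> depends only on the class of
    the middle factor at the same \<open>\<theta>\<close>, which yields the continuity of
    conjugation.\<close>
  have conj_cong: "(u \<odot> x \<odot> v) \<theta> = (u \<odot> y \<odot> v) \<theta>"
    if "u \<in> free_prof" "v \<in> free_prof" "x \<in> free_prof" "y \<in> free_prof" "fin_cong \<theta>" "x \<theta> = y \<theta>" for u v x y \<theta>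
    using that(5,6) by (simp add: free_prof_mult_def)
  have F_cong: "F x = F y" if "x \<in> carrier G" "y \<in> carrier G" "x weight_cong = y weight_cong" for x y
    unfolding F_def using that st G_free
    by (intro weight_value_cong conj_cong fin_cong_weight_cong free_prof_mult_closed) blast+
  have rank_lower: "3 \<le> card X" if X: "top_generates G (schutz_topology G) X" "finite X" for X
  proof -
    have XG: "X \<subseteq> carrier G" "Abstract_Topology.closure_of (schutz_topology G) (generate G X) = carrier G"
      using X(1) by (auto simp: top_generates_def)
    have "d \<in> generate dih18 (F ` X)" for d
    proof -
      obtain g where g: "g \<in> carrier G" "F g = d"
        using F_surj by (metis UNIV_I imageE)
      then obtain a where a: "a \<in> generate G X" "a weight_cong = g weight_cong"
        using XG closure_of_schutz_topology[OF G_free group.generate_incl[OF group_G XG(1)]] fin_cong_weight_cong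
        by blast
      then have "F a = d"
        using F_cong g group.generate_incl[OF group_G XG(1)] by blast
      then show ?thesis
        using a(1) F.generate_img[OF XG(1)] by blast
    qed
    then have "3 \<le> card (F ` X)"
      using dih18_generators_card[of "F ` X"] X(2) by blast
    also have "\<dots> \<le> card X"
      by (rule card_image_le[OF X(2)])
    finally show ?thesis .
  qed
  define X where "X = (\<lambda>x. s \<odot> x \<odot> t) ` tm_generators"
  have XG: "X \<subseteq> carrier G"
    unfolding X_def using \<alpha>.hom_closed tm_generators_subset by blast
  have "Abstract_Topology.closure_of (schutz_topology G) (generate G X) = carrier G"
    unfolding closure_of_schutz_topology[OF G_free group.generate_incl[OF group_G XG]]
  proof (intro Set.set_eqI iffI CollectI conjI allI impI)
    fix g \<theta> assume g: "g \<in> carrier G" and \<theta>: "fin_cong (\<theta> :: (letter list \<times> letter list) set)"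
    have tg: "t \<odot> g \<odot> s \<in> carrier tm_group"
      using \<beta> g by (auto simp: hom_def)
    then obtain h where h: "h \<in> generate tm_group tm_generators" "h \<theta> = (t \<odot> g \<odot> s) \<theta>"
      using tm_generators_dense[OF _ \<theta>] by blast
    then have "h \<in> free_prof"
      using group.generate_incl[OF group_tm_group tm_generators_subset] tm_free by blast
    then have "(s \<odot> h \<odot> t) \<theta> = (s \<odot> (t \<odot> g \<odot> s) \<odot> t) \<theta>"
      using st tg tm_free h(2) \<theta> by (intro conj_cong) auto
    moreover have "s \<odot> h \<odot> t \<in> generate G X"
      unfolding X_def using \<alpha>.generate_img[OF tm_generators_subset] h(1) by blast
    ultimately show "\<exists>a \<in> generate G X. a \<theta> = g \<theta>"
      using \<alpha>\<beta> g by auto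
  qed auto
  then have X_gen: "top_generates G (schutz_topology G) X"
    using XG by (simp add: top_generates_def)
  have "finite X"
    by (simp add: X_def)
  \<comment> \<open>An upper bound suffices: the lower bound for generating sets then forces the
    three conjugated generators to be distinct.\<close>
  moreover have "card X \<le> 3"
    unfolding X_def by (rule order_trans[OF card_image_le]) (simp_all add: card_insert_if)
  ultimately have "card X = 3"
    using rank_lower[OF X_gen] by simp
  then show "has_rank G (schutz_topology G) 3"
    unfolding has_rank_def using X_gen \<open>finite X\<close> rank_lower by blast
  obtain H :: "nat monoid" and h where H: "group H" "h \<in> hom dih18 H" "bij_betw h (carrier dih18) (carrier H)"
    using isomorphic_nat_monoid[OF group_dih18] by auto
  have "order H = 18"
    using bij_betw_same_card[OF H(3)] order_dih18 by (simp add: order_def)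
  moreover have "has_rank H (discrete_topology (carrier H)) 3"
    by (rule has_rank_discrete_iso[OF group_dih18 H, of dih18_generators])
      (use generate_dih18 dih18_generators_card in simp_all)
  moreover have "continuous_hom_image G (schutz_topology G) H (discrete_topology (carrier H))"
    unfolding continuous_hom_image_def
  proof (intro bexI conjI)
    show "h \<circ> F \<in> hom G H"
      by (rule hom_compose[OF F_hom H(2)])
    show im: "(h \<circ> F) ` carrier G = carrier H"
      using F_surj H(3) unfolding bij_betw_def image_comp[symmetric] by simp
    show "continuous_map (schutz_topology G) (discrete_topology (carrier H)) (h \<circ> F)"
    proof (rule continuous_map_schutz_discrete[OF G_free fin_cong_weight_cong])
      show "(h \<circ> F) x = (h \<circ> F) y"
        if "x \<in> carrier G" "y \<in> carrier G" "x weight_cong = y weight_cong" for x y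
        using F_cong[OF that] by simp
    qed (simp only: im order_refl)
  qed
  ultimately show "\<exists>H :: nat monoid. group H \<and> order H = 18 \<and>
      has_rank H (discrete_topology (carrier H)) 3 \<and>
      continuous_hom_image G (schutz_topology G) H (discrete_topology (carrier H))"
    using H(1) by (intro exI[of _ H] conjI)
qed

theorem theorem7p7:
  shows "(\<exists>G. is_schutz_group thue_morse G) \<and>
    (\<forall>G. is_schutz_group thue_morse G \<longrightarrow>
       (\<exists>H :: nat monoid. group H \<and> order H = 18 \<and>
          has_rank H (discrete_topology (carrier H)) 3 \<and>
          continuous_hom_image G (schutz_topology G) H (discrete_topology (carrier H))) \<and>
       has_rank G (schutz_topology G) 3)"
proof -
  obtain f where "tm_idempotent f"
    using tm_idempotent_exists by blast
  then interpret tm_idempotent f .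
  have J: "J_class thue_morse = lang_closure tm_language - embed_word ` tm_language"
    unfolding J_class_def by (subst closure_of_embed_word) (auto simp: subst_language_def)
  \<comment> \<open>A realization exists, so the universally quantified part is not vacuous.\<close>
  have "is_schutz_group thue_morse tm_group"
    unfolding is_schutz_group_def J
  proof (intro conjI subsetI DiffI)
    show "maximal_subgroup free_prof (\<odot>) tm_group"
      by (rule TM.maximal_subgroup_local_group[OF f_closure f_idem])
    fix x assume x: "x \<in> carrier tm_group"
    then show "x \<in> lang_closure tm_language"
      by (simp add: local_group_def)
    show "x \<notin> embed_word ` tm_language"
      by (rule TM.local_group_disjoint_words[OF f_closure x])
  qed
  moreover have "(\<exists>H :: nat monoid. group H \<and> order H = 18 \<and>
      has_rank H (discrete_topology (carrier H)) 3 \<and>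
      continuous_hom_image G (schutz_topology G) H (discrete_topology (carrier H))) \<and>
    has_rank G (schutz_topology G) 3" if G: "is_schutz_group thue_morse G" for G
  proof -
    have "maximal_subgroup free_prof (\<odot>) G" "carrier G \<subseteq> lang_closure tm_language"
      using G unfolding is_schutz_group_def J by (simp, elim conjE, simp add: Diff_subset_conv subset_iff)
    then obtain e where "e \<in> lang_closure tm_language" "e \<odot> e = e" "G = local_group tm_language e"
      by (rule TM.maximal_subgroup_is_local_group)
    then show ?thesis
      using schutz_group_properties by simp
  qed
  ultimately show ?thesis by blast
qed

end
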